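(* Let $\Xi'_N=\mathrm{supp}(P'_N)$ denote the (finite) support of the empirical measure $P'_N$. Let $\delta>0$, $r>0$ and $z\in Z$. Then $$\tilde c^\delta(z,P'_N)=\sup\ \mathbf E_Q[\ell(z,\xi)]$$ where the supremum is over all $Q\in\mathcal P(\Xi)$, $\hat P'\in\mathcal M_+(\Xi')$, $T\in\mathcal M_+(\Xi'\times\Xi'_N)$ subject to $$I(\hat P',Q)\le r,\qquad \Pi_{\Xi'}T=\hat P',\qquad \Pi_{\Xi'_N}T=P'_N,\qquad \int_{\Xi'\times\Xi'_N}\mathbb 1\{\|\xi'-\xi'_i\|\le\delta\}\,dT(\xi',\xi'_i)\ge1-\delta .$$
   Context: $\Xi,\Xi'$ are Polish spaces, the distance on $\Xi'$ being written $\|s-s'\|$; $\mathcal P(\cdot)$ and $\mathcal M_+(\cdot)$ denote Borel probability measures and positive Borel measures. $\ell:Z\times\Xi\to\mathbb R$ is a loss function. $O:\Xi\to\mathcal P(\Xi')$ is an observational model (Markov kernel), $(O\star Q)(B)=\int O_\xi(B)\,dQ(\xi)$, and $P'_N=\frac1N\sum_{i=1}^N\delta_{\xi'_i}$ is the empirical measure of noisy observations $\xi'_1,\dots,\xi'_N\in\Xi'$. $\Pi_{\Xi'}T$, $\Pi_{\Xi'_N}T$ denote the marginals of $T$. $I(\hat P',Q)=\mathrm{KL}(\hat P',O\star Q)$, with $\mathrm{KL}(\mu,\nu)=\int\log\frac{d\mu}{d\nu}d\mu-\int d\mu+\int d\nu$ if $\mu\ll\nu$, $+\infty$ otherwise.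 $I^\delta(\mu,\nu)=\inf\{I(\upsilon,\nu):\upsilon\in\mathcal P(\Xi'),\ \mathrm{LP}(\upsilon,\mu)\le\delta\}$, where $\mathrm{LP}$ is the Lévy–Prokhorov metric, with $\mathrm{LP}(\hat P',P'_N)\le\delta$ iff $P'_N(B)\le\hat P'(B^\delta)+\delta$ for all Borel $B\subseteq\Xi'$, $B^\delta=\{s'\in\Xi':\|s-s'\|\le\delta\text{ for some }s\in B\}$. It is assumed that nothing is known about the distribution of the noiseless data, i.e. $\mathcal P=\mathcal P(\Xi)$, so the predictor is $\tilde c^\delta(z,P'_N)=\sup\{\mathbf E_Q[\ell(z,\xi)]:Q\in\mathcal P(\Xi),\ I^\delta(P'_N,Q)\le r\}$, which the paper equivalently writes as the supremum of $\mathbf E_Q[\ell(z,\xi)]$ over $Q\in\mathcal P(\Xi)$, $\hat P'\in\mathcal P(\Xi')$ with $I(\hat P',Q)\le r$, $\mathrm{LP}(\hat P',P'_N)\le\delta$. Suprema over empty sets are $-\infty$. *)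

theory Defs
  imports "HOL-Probability.Probability"
begin

definition pos_measures :: "'a measure \<Rightarrow> 'a measure set" where
  "pos_measures A = {M. sets M = sets A}"

(* Extended-real integral, the difference of the integrals of the positive and negative parts
   (infinity - infinity = infinity in type ereal). The Bochner integral is unsuitable here: it is 0
   when f is not integrable, even if the integral of f is plus or minus infinity. *)
definition ext_integral :: "'a measure \<Rightarrow> ('a \<Rightarrow> real) \<Rightarrow> ereal" where
  "ext_integral M f =
     enn2ereal (\<integral>\<^sup>+x. ennreal (f x) \<partial>M) - enn2ereal (\<integral>\<^sup>+x. ennreal (- f x) \<partial>M)"

(* RN_deriv nu mu is finite and positive mu-almost everywhere for finite mu, nu with mu << nu, so
   the conventions enn2real infinity = 0 and ln 0 = 0 do not matter. The negative part of the
   logarithm is then mu-integrable, so the first term is well defined (possibly infinity).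
   The library's KL_divergence is real-valued and has its arguments in the opposite order. *)
definition KL :: "'a measure \<Rightarrow> 'a measure \<Rightarrow> ereal" where
  "KL \<mu> \<nu> =
     (if absolutely_continuous \<nu> \<mu>
      then ext_integral \<mu> (\<lambda>x. ln (enn2real (RN_deriv \<nu> \<mu> x)))
             - enn2ereal (emeasure \<mu> (space \<mu>)) + enn2ereal (emeasure \<nu> (space \<nu>))
      else \<infinity>)"

(* The Levy-Prokhorov metric, with open enlargements, which are always Borel. *)
definition LP :: "'b::metric_space measure \<Rightarrow> 'b measure \<Rightarrow> real" where
  "LP \<mu> \<nu> = Inf {e. 0 < e \<and> (\<forall>A\<in>sets borel.
      measure \<mu> A \<le> measure \<nu> (\<Union>x\<in>A. ball x e) + e \<and>
      measure \<nu> A \<le> measure \<mu> (\<Union>x\<in>A. ball x e) + e)}"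

(* bind Q K is the measure taking B to the integral of emeasure (K x) B with respect to Q(dx). *)
definition obs_div :: "('a \<Rightarrow> 'b measure) \<Rightarrow> 'b measure \<Rightarrow> 'a measure \<Rightarrow> ereal" where
  "obs_div K P Q = KL P (bind Q K)"

definition obs_div_smooth ::
  "real \<Rightarrow> ('a \<Rightarrow> 'b measure) \<Rightarrow> 'b::metric_space measure \<Rightarrow> 'a measure \<Rightarrow> ereal" where
  "obs_div_smooth \<delta> K \<mu> Q =
     Inf {obs_div K \<upsilon> Q | \<upsilon>. \<upsilon> \<in> space (prob_algebra borel) \<and> LP \<upsilon> \<mu> \<le> \<delta>}"

definition predictor ::
  "('z \<Rightarrow> 'a::topological_space \<Rightarrow> real) \<Rightarrow> ('a \<Rightarrow> 'b::metric_space measure) \<Rightarrow> real \<Rightarrow> real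
     \<Rightarrow> 'z \<Rightarrow> 'b measure \<Rightarrow> ereal" where
  "predictor l K r \<delta> z \<mu> =
     Sup {ext_integral Q (l z) | Q.
            Q \<in> space (prob_algebra borel) \<and> obs_div_smooth \<delta> K \<mu> Q \<le> ereal r}"

definition empirical :: "nat \<Rightarrow> (nat \<Rightarrow> 'b::topological_space) \<Rightarrow> 'b measure" where
  "empirical N s = distr (uniform_count_measure {1..N}) borel s"

definition supp :: "'b::topological_space measure \<Rightarrow> 'b set" where
  "supp \<mu> = {x. \<forall>U. open U \<and> x \<in> U \<longrightarrow> 0 < emeasure \<mu> U}"

lemma sets_empirical [simp, measurable_cong]: "sets (empirical N s) = sets borel"
  by (simp add: empirical_def)

lemma prob_space_empirical: "1 \<le> N \<Longrightarrow> prob_space (empirical N s)"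
  unfolding empirical_def
  by (intro prob_space.prob_space_distr prob_space_uniform_count_measure)
     (auto simp: measurable_def sets_uniform_count_measure space_uniform_count_measure)

lemma measure_empirical:
  assumes "B \<in> sets borel"
  shows "measure (empirical N s) B = (\<Sum>i=1..N. indicator B (s i)) / N"
proof -
  have "measure (empirical N s) B = measure (uniform_count_measure {1..N}) {i\<in>{1..N}. s i \<in> B}"
    unfolding empirical_def using assms
    by (subst measure_distr)
       (auto simp: measurable_def sets_uniform_count_measure space_uniform_count_measure
             intro!: arg_cong[where f="measure _"])
  also have "\<dots> = card {i\<in>{1..N}. s i \<in> B} / N"
    by (subst measure_uniform_count_measure) auto
  also have "real (card {i\<in>{1..N}. s i \<in> B}) = (\<Sum>i=1..N. indicator B (s i))"
    by (simp add: indicator_def of_bool_def flip: sum.inter_filter)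
  finally show ?thesis .
qed

lemma supp_empirical:
  fixes s :: "nat \<Rightarrow> 'b::t1_space"
  assumes "1 \<le> N"
  shows "supp (empirical N s) = s ` {1..N}"
proof -
  interpret prob_space "empirical N s" by (rule prob_space_empirical[OF assms])
  have pos: "0 < emeasure (empirical N s) U \<longleftrightarrow> (\<exists>i\<in>{1..N}. s i \<in> U)" if "open U" for U
    using assms that
    by (auto simp: emeasure_eq_measure measure_empirical zero_less_divide_iff indicator_def
          of_bool_def sum_nonneg less_le sum_nonneg_eq_0_iff split: if_splits)
  show ?thesis
  proof (intro set_eqI iffI)
    fix x assume "x \<in> supp (empirical N s)"
    moreover have "open (- (s ` {1..N}))"
      by (intro open_Compl finite_imp_closed) auto
    ultimately show "x \<in> s ` {1..N}"
      using pos by (fastforce simp: supp_def)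
  qed (use pos in \<open>auto simp: supp_def\<close>)
qed

(* The closed enlargement of a Borel set B need not be Borel, so its measure is expressed as an
   outer measure, through the Borel sets C containing it. *)
lemma LP_empirical_le_iff:
  fixes s :: "nat \<Rightarrow> 'b::metric_space"
  assumes \<mu>: "\<mu> \<in> space (prob_algebra borel)" and N: "1 \<le> N" and \<delta>: "0 < \<delta>"
  shows "LP \<mu> (empirical N s) \<le> \<delta> \<longleftrightarrow>
    (\<forall>B\<in>sets borel. \<forall>C\<in>sets borel. (\<Union>x\<in>B. cball x \<delta>) \<subseteq> C \<longrightarrow>
        measure (empirical N s) B \<le> measure \<mu> C + \<delta>)"
    (is "?L \<longleftrightarrow> ?R")
proof
  let ?P = "empirical N s"
  interpret P: prob_space ?P by (rule prob_space_empirical[OF N])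
  interpret M: prob_space \<mu> using \<mu> by (simp add: space_prob_algebra)
  have [simp, measurable_cong]: "sets \<mu> = sets borel" using \<mu> by (simp add: space_prob_algebra)
  then have [simp]: "space \<mu> = UNIV" by (metis space_borel sets_eq_imp_space_eq)
  have [simp]: "space ?P = UNIV" by (simp add: empirical_def)
  let ?E = "{e. 0 < e \<and> (\<forall>A\<in>sets borel.
      measure \<mu> A \<le> measure ?P (\<Union>x\<in>A. ball x e) + e \<and>
      measure ?P A \<le> measure \<mu> (\<Union>x\<in>A. ball x e) + e)}"
  have ob [simp]: "(\<Union>x\<in>A. ball x e) \<in> sets borel" for A :: "'b set" and e
    by (intro borel_open open_UN) auto
  have bdd: "bdd_below ?E" by (intro bdd_belowI[of _ 0]) auto
  have ne: "?E \<noteq> {}"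
    by (auto intro!: exI[of _ 1] add_increasing M.prob_le_1 P.prob_le_1)
  {
    assume L: ?L
    have near: "measure ?P A \<le> measure \<mu> (\<Union>x\<in>A. ball x e) + e"
      if e: "\<delta> < e" and A: "A \<in> sets borel" for e A
    proof -
      from L e have "Inf ?E < e" by (simp add: LP_def)
      then obtain e' where e': "e' \<in> ?E" "e' < e"
        using cInf_less_iff[OF ne bdd] by auto
      then have "measure ?P A \<le> measure \<mu> (\<Union>x\<in>A. ball x e') + e'" using A by auto
      also have "measure \<mu> (\<Union>x\<in>A. ball x e') \<le> measure \<mu> (\<Union>x\<in>A. ball x e)"
        using e' by (intro M.finite_measure_mono) (auto intro: less_trans)
      finally show ?thesis using e' by simp
    qed
    show ?R
    proof (intro ballI impI)
      fix B C :: "'b set"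
      assume B: "B \<in> sets borel" and C: "C \<in> sets borel" and BC: "(\<Union>x\<in>B. cball x \<delta>) \<subseteq> C"
      define F where "F = B \<inter> s ` {1..N}"
      define G where "G n = (\<Union>x\<in>F. ball x (\<delta> + 1 / real (Suc n)))" for n
      have F: "finite F" "F \<in> sets borel"
        by (auto simp: F_def intro!: sets.Int B borel_closed finite_imp_closed)
      have PF: "measure ?P B = measure ?P F"
        using B F by (auto simp: measure_empirical F_def indicator_def intro!: sum.cong)
      have "(\<Inter>n. G n) \<subseteq> (\<Union>x\<in>F. cball x \<delta>)"
      proof
        fix y assume y: "y \<in> (\<Inter>n. G n)"
        show "y \<in> (\<Union>x\<in>F. cball x \<delta>)"
        proof (rule ccontr)
          assume "\<not> ?thesis"
          then have gt: "\<delta> < dist x y" if "x \<in> F" for x using that by force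
          from y have "F \<noteq> {}" by (auto simp: G_def)
          define d where "d = Min ((\<lambda>x. dist x y) ` F)"
          have "\<delta> < d" using gt F \<open>F \<noteq> {}\<close> by (auto simp: d_def)
          then obtain n where n: "inverse (real (Suc n)) < d - \<delta>"
            using reals_Archimedean[of "d - \<delta>"] by auto
          from y obtain x where "x \<in> F" "dist x y < \<delta> + 1 / real (Suc n)"
            by (auto simp: G_def)
          moreover have "d \<le> dist x y" using F \<open>x \<in> F\<close> by (auto simp: d_def)
          ultimately show False using n by (simp add: inverse_eq_divide)
        qed
      qed
      then have sub: "(\<Inter>n. G n) \<subseteq> C" using BC by (auto simp: F_def)
      have "decseq G"
        unfolding decseq_def G_def
        by (intro allI impI UN_mono subset_ball) (auto intro!: divide_left_mono)
      moreover have "range G \<subseteq> sets \<mu>" by (auto simp: G_def)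
      ultimately have "(\<lambda>n. measure \<mu> (G n)) \<longlonglongrightarrow> measure \<mu> (\<Inter>n. G n)"
        by (intro M.finite_Lim_measure_decseq)
      moreover have "(\<lambda>n. \<delta> + 1 / real (Suc n)) \<longlonglongrightarrow> \<delta> + 0"
        using LIMSEQ_inverse_real_of_nat by (intro tendsto_intros) (simp add: inverse_eq_divide)
      ultimately have "(\<lambda>n. measure \<mu> (G n) + (\<delta> + 1 / real (Suc n)))
          \<longlonglongrightarrow> measure \<mu> (\<Inter>n. G n) + (\<delta> + 0)"
        by (rule tendsto_add)
      then have "measure ?P F \<le> measure \<mu> (\<Inter>n. G n) + (\<delta> + 0)"
        by (rule LIMSEQ_le_const) (use near[OF _ F(2)] in \<open>auto simp: G_def\<close>)
      also have "measure \<mu> (\<Inter>n. G n) \<le> measure \<mu> C"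
        using sub C by (intro M.finite_measure_mono) auto
      finally show "measure ?P B \<le> measure \<mu> C + \<delta>" using PF by simp
    qed
  }
  {
    assume R: ?R
    have "e \<in> ?E" if e: "\<delta> < e" for e
    proof -
      have le: "measure ?P A \<le> measure \<mu> (\<Union>x\<in>A. ball x e) + \<delta>" if "A \<in> sets borel" for A
        using R that ob e by (force intro!: bspec[OF bspec[OF R], THEN mp])
      have ge: "measure \<mu> A \<le> measure ?P (\<Union>x\<in>A. ball x e) + \<delta>" if A: "A \<in> sets borel" for A
      proof -
        let ?C = "- (\<Union>x\<in>A. ball x e)"
        have C: "?C \<in> sets borel" by (rule borel_comp[OF ob])
        have "measure ?P ?C \<le> measure \<mu> (- A) + \<delta>"
        proof (rule R[rule_format, OF C])
          show "- A \<in> sets borel" using A by auto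
          show "(\<Union>x\<in>?C. cball x \<delta>) \<subseteq> - A"
            using e by (force simp: dist_commute)
        qed
        moreover have "measure ?P ?C = 1 - measure ?P (\<Union>x\<in>A. ball x e)"
          using P.prob_compl[of "\<Union>x\<in>A. ball x e"] ob by (simp add: Compl_eq_Diff_UNIV)
        moreover have "measure \<mu> (- A) = 1 - measure \<mu> A"
          using M.prob_compl[of A] A by (simp add: Compl_eq_Diff_UNIV)
        ultimately show ?thesis by simp
      qed
      show ?thesis using e \<delta> le ge by (fastforce intro: order_trans)
    qed
    then have "Inf ?E \<le> e" if "\<delta> < e" for e
      using that by (intro cInf_lower bdd) auto
    then have "Inf ?E \<le> \<delta>" by (rule dense_ge)
    then show ?L by (simp add: LP_def)
  }
qed

end

theory Submission
  imports Defs "HOL-Real_Asymp.Real_Asymp"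
begin

text \<open>
Both sides are suprema of the same function of \<open>Q\<close>, so it is enough that, for each \<open>Q\<close>, the
smoothed divergence is at most \<open>r\<close> iff there are a measure \<open>P\<close> of divergence at most \<open>r\<close> and a coupling
\<open>T\<close> of \<open>P\<close> with the empirical measure that keeps the coordinates within \<open>\<delta>\<close> with
probability at least \<open>1 - \<delta>\<close>. Two facts give this.

The first one is Strassen's theorem: such a coupling exists iff \<open>P\<close> is within
Levy-Prokhorov distance \<open>\<delta>\<close> of the empirical measure. As the empirical measure has finite support,
this reduces to a transport problem with finitely many sources and sinks, solved by a version of Hall's theorem
for real masses (\<open>finite_strassen\<close>, \<open>coupling_of_near\<close>, \<open>near_of_coupling\<close>).

The second one is that the infimum in the smoothed divergence is attained. This matters because
the smoothed divergence may equal \<open>r\<close>, and then nearly optimal measures would all violate the bound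
\<open>r\<close>. The measures in question form a convex set that is closed under convergence
on every Borel set, and the strict convexity of relative entropy makes minimizing sequences Cauchy in
\<open>L\<^sup>1\<close> (\<open>KL_infimum_attained\<close>).
\<close>

section \<open>Finite transport problems\<close>

text \<open>A plan ships mass from the sources \<open>X\<close> with supplies \<open>m\<close> to the sinks \<open>Y\<close> with demands
\<open>p\<close> along the edges of \<open>R\<close>. The definition is asymmetric, as in Hall's theorem: all demands are
met exactly, while part of the supply may be left over.\<close>

definition transport_plan ::
  "('x \<Rightarrow> 'y \<Rightarrow> bool) \<Rightarrow> 'x set \<Rightarrow> 'y set \<Rightarrow> ('x \<Rightarrow> real) \<Rightarrow> ('y \<Rightarrow> real) \<Rightarrow> ('x \<Rightarrow> 'y \<Rightarrow> real) \<Rightarrow> bool"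
  where
  "transport_plan R X Y m p t \<longleftrightarrow>
     (\<forall>x\<in>X. \<forall>y\<in>Y. 0 \<le> t x y \<and> (t x y \<noteq> 0 \<longrightarrow> R x y)) \<and>
     (\<forall>y\<in>Y. (\<Sum>x\<in>X. t x y) = p y) \<and> (\<forall>x\<in>X. (\<Sum>y\<in>Y. t x y) \<le> m x)"

lemma transport_plan_union:
  assumes fin: "finite X" "finite Y" and A: "A \<subseteq> X" and F: "F \<subseteq> Y"
    and t1: "transport_plan R A F m p t1" and t2: "transport_plan R (X - A) (Y - F) m p t2"
  shows "transport_plan R X Y m p
    (\<lambda>x y. if x \<in> A \<and> y \<in> F then t1 x y else if x \<notin> A \<and> y \<notin> F then t2 x y else 0)"
    (is "transport_plan R X Y m p ?t")
proof -
  have col: "(\<Sum>x\<in>X. ?t x y) = (\<Sum>x\<in>A. ?t x y) + (\<Sum>x\<in>X - A. ?t x y)" for y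
    using fin A by (subst sum.subset_diff[of A X]) auto
  have row: "(\<Sum>y\<in>Y. ?t x y) = (\<Sum>y\<in>F. ?t x y) + (\<Sum>y\<in>Y - F. ?t x y)" for x
    using fin F by (subst sum.subset_diff[of F Y]) auto
  have "(\<Sum>x\<in>X. ?t x y) = p y" if "y \<in> Y" for y
    using t1 t2 that unfolding col by (cases "y \<in> F") (auto simp: transport_plan_def)
  moreover have "(\<Sum>y\<in>Y. ?t x y) \<le> m x" if "x \<in> X" for x
    using t1 t2 that unfolding row by (cases "x \<in> A") (auto simp: transport_plan_def)
  ultimately show ?thesis
    using t1 t2 by (auto simp: transport_plan_def)
qed

text \<open>Hall's theorem for real masses. The proof is a Halmos-Vaughan induction on the number of
vertices. If a set \<open>F\<close> of sinks is critical, that is, its demand uses up the whole supply of a set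
\<open>A\<close> of sources containing all its neighbours, then Hall's condition passes both to \<open>(A, F)\<close> and
to the complementary pair, and the two plans are put together. A sink without demand can simply be
removed. In general, mass is pushed along one edge \<open>(x0, y0)\<close> until one of these situations occurs.\<close>

lemma transport_plan_exists:
  fixes m :: "'x \<Rightarrow> real" and p :: "'y \<Rightarrow> real"
  assumes "finite X" "finite Y" and "\<forall>x\<in>X. 0 \<le> m x" "\<forall>y\<in>Y. 0 \<le> p y"
    and "\<forall>F\<subseteq>Y. sum p F \<le> sum m {x\<in>X. \<exists>y\<in>F. R x y}"
  shows "\<exists>t. transport_plan R X Y m p t"
  using assms
proof (induction "card X + card Y" arbitrary: X Y m p rule: less_induct)
  case (less X Y)
  note fin = less.prems(1,2)
  define N where "N F = {x\<in>X. \<exists>y\<in>F. R x y}" for F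
  have finN: "finite (N F)" for F using fin by (auto simp: N_def)
  have split: "\<exists>t. transport_plan R X Y m p t"
    if m: "\<forall>x\<in>X. 0 \<le> m x" and p: "\<forall>y\<in>Y. 0 \<le> p y" and hall: "\<forall>F\<subseteq>Y. sum p F \<le> sum m (N F)"
      and A: "A \<subseteq> X" and F: "F \<subseteq> Y" and NF: "N F \<subseteq> A" and tight: "sum m A = sum p F"
      and small: "card A + card F \<noteq> 0" "card A + card F < card X + card Y"
    for m :: "'x \<Rightarrow> real" and p A F
  proof -
    have finAF: "finite A" "finite F" using fin A F finite_subset by auto
    have "\<exists>t. transport_plan R A F m p t"
    proof (rule less.hyps)
      show "\<forall>G\<subseteq>F. sum p G \<le> sum m {x\<in>A. \<exists>y\<in>G. R x y}"
      proof (intro allI impI)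
        fix G assume G: "G \<subseteq> F"
        have "{x\<in>A. \<exists>y\<in>G. R x y} = N G" using NF A G by (auto simp: N_def)
        then show "sum p G \<le> sum m {x\<in>A. \<exists>y\<in>G. R x y}" using hall G F by auto
      qed
    qed (use small finAF m p A F in auto)
    then obtain t1 where t1: "transport_plan R A F m p t1" ..
    have "card (X - A) + card (Y - F) < card X + card Y"
    proof -
      have "card A \<le> card X" "card F \<le> card Y" using card_mono fin A F by auto
      moreover have "card (X - A) = card X - card A" "card (Y - F) = card Y - card F"
        by (simp_all add: card_Diff_subset finAF A F)
      ultimately show ?thesis using small by linarith
    qed
    then have "\<exists>t. transport_plan R (X - A) (Y - F) m p t"
    proof (rule less.hyps)
      show "\<forall>G\<subseteq>Y - F. sum p G \<le> sum m {x\<in>X - A. \<exists>y\<in>G. R x y}"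
      proof (intro allI impI)
        fix G assume G: "G \<subseteq> Y - F"
        let ?B = "{x\<in>X - A. \<exists>y\<in>G. R x y}"
        have "finite G" using fin G finite_subset by blast
        then have "sum p G + sum p F = sum p (G \<union> F)"
          using finAF G by (subst sum.union_disjoint) auto
        also have "\<dots> \<le> sum m (N (G \<union> F))"
          by (rule hall[rule_format]) (use G F in auto)
        also have "\<dots> \<le> sum m (?B \<union> A)"
          using NF fin m A finAF by (intro sum_mono2) (auto simp: N_def)
        also have "\<dots> = sum m ?B + sum m A"
          using fin finAF by (intro sum.union_disjoint) auto
        finally show "sum p G \<le> sum m ?B" using tight by simp
      qed
    qed (use fin m p in auto)
    then obtain t2 where t2: "transport_plan R (X - A) (Y - F) m p t2" ..
    show ?thesis using transport_plan_union[OF fin A F t1 t2] by blast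
  qed
  have drop: "\<exists>t. transport_plan R X Y m p t"
    if m: "\<forall>x\<in>X. 0 \<le> m x" and p: "\<forall>y\<in>Y. 0 \<le> p y" and hall: "\<forall>F\<subseteq>Y. sum p F \<le> sum m (N F)"
      and y: "y \<in> Y" and 0: "p y = 0" for m :: "'x \<Rightarrow> real" and p y
  proof -
    have "card (Y - {y}) < card Y" using fin y by (intro psubset_card_mono) auto
    then have "\<exists>t. transport_plan R X (Y - {y}) m p t"
      using fin m p hall by (intro less.hyps) (auto simp: N_def)
    then obtain t where "transport_plan R (X - {}) (Y - {y}) m p t" by auto
    moreover have "transport_plan R {} {y} m p (\<lambda>x y. 0)" using 0 by (simp add: transport_plan_def)
    ultimately show ?thesis using transport_plan_union[OF fin, of "{}" "{y}" R m p] y by blast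
  qed
  note m = less.prems(3) and p = less.prems(4)
  have hall: "\<forall>F\<subseteq>Y. sum p F \<le> sum m (N F)" using less.prems(5) by (simp add: N_def)
  show ?case
  proof (cases "\<exists>y\<in>Y. p y \<noteq> 0")
    case False
    then have "transport_plan R X Y m p (\<lambda>x y. 0)" using m by (auto simp: transport_plan_def)
    then show ?thesis by blast
  next
    case True
    then obtain y0 where y0: "y0 \<in> Y" "0 < p y0" using p by force
    have "0 < sum m (N {y0})" using hall[rule_format, of "{y0}"] y0 by simp
    then obtain x0 where x0: "x0 \<in> X" "R x0 y0" "0 < m x0"
      using sum_nonpos[of "N {y0}" m] by (force simp: N_def)
    define \<F> where "\<F> = {F. F \<subseteq> Y - {y0} \<and> x0 \<in> N F}"
    \<comment> \<open>The slack of every constraint that pushing mass from x0 to y0 can violate: the supply of x0, the demand of y0, and Hall's condition for each F that sees x0 but does not contain y0. Only for such F does the push lower the right-hand side alone.\<close>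
    define E where "E = insert (m x0) (insert (p y0) ((\<lambda>F. sum m (N F) - sum p F) ` \<F>))"
    have finE: "finite E"
      unfolding E_def \<F>_def using fin by (auto intro!: finite_subset[of _ "Pow Y"])
    define e where "e = Min E"
    have e_le: "e \<le> a" if "a \<in> E" for a using that finE by (simp add: e_def)
    have e0: "0 \<le> e"
      unfolding e_def using finE m p x0 y0 hall by (subst Min_ge_iff) (auto simp: E_def \<F>_def)
    have eE: "e \<in> E" unfolding e_def using finE by (intro Min_in) (auto simp: E_def)
    define m' where "m' = m(x0 := m x0 - e)"
    define p' where "p' = p(y0 := p y0 - e)"
    have sum_m': "sum m' A = sum m A - (if x0 \<in> A then e else 0)" if "finite A" for A
      using that by (auto simp: m'_def sum.remove[of A x0] intro!: sum.cong)
    have sum_p': "sum p' A = sum p A - (if y0 \<in> A then e else 0)" if "finite A" for A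
      using that by (auto simp: p'_def sum.remove[of A y0] intro!: sum.cong)
    have m'0: "\<forall>x\<in>X. 0 \<le> m' x" using m e_le[of "m x0"] by (auto simp: m'_def E_def)
    have p'0: "\<forall>y\<in>Y. 0 \<le> p' y" using p e_le[of "p y0"] by (auto simp: p'_def E_def)
    have hall': "\<forall>F\<subseteq>Y. sum p' F \<le> sum m' (N F)"
    proof (intro allI impI)
      fix F assume F: "F \<subseteq> Y"
      then have finF: "finite F" using fin finite_subset by blast
      have "sum p F \<le> sum m (N F)" using hall F by blast
      moreover have "x0 \<in> N F" if "y0 \<in> F" using that x0 by (auto simp: N_def)
      moreover have "e \<le> sum m (N F) - sum p F" if "x0 \<in> N F" "y0 \<notin> F"
        using that F by (intro e_le) (auto simp: E_def \<F>_def)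
      ultimately show "sum p' F \<le> sum m' (N F)" by (auto simp: sum_m' sum_p' finF finN)
    qed
    have "\<exists>t. transport_plan R X Y m' p' t"
      using eE unfolding E_def
    proof (elim insertE imageE)
      \<comment> \<open>Then x0 is exhausted: the pair of the source x0 and the empty set of sinks is critical.\<close>
      assume "e = m x0"
      moreover have "0 < card X" "0 < card Y" using x0 y0 fin by (auto simp: card_gt_0_iff)
      then have "Suc 0 < card X + card Y" by linarith
      ultimately show ?thesis
        using x0 by (intro split[OF m'0 p'0 hall', of "{x0}" "{}"]) (auto simp: N_def m'_def)
    next
      assume "e = p y0"
      then show ?thesis using y0 by (intro drop[OF m'0 p'0 hall', of y0]) (auto simp: p'_def)
    next
      fix F assume e: "e = sum m (N F) - sum p F" and F: "F \<in> \<F>"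
      have finF: "finite F" "F \<noteq> {}" using F fin finite_subset by (auto simp: \<F>_def N_def)
      have "card F < card Y" using F y0 fin by (intro psubset_card_mono) (auto simp: \<F>_def)
      moreover have "card (N F) \<le> card X" using fin by (intro card_mono) (auto simp: N_def)
      moreover have "sum m' (N F) = sum p' F"
        using F e finF finN by (auto simp: \<F>_def sum_m' sum_p')
      ultimately show ?thesis
        using F finF
        by (intro split[OF m'0 p'0 hall', of "N F" F]) (auto simp: \<F>_def N_def)
    qed
    then obtain t where t: "transport_plan R X Y m' p' t" ..
    define t' where "t' x y = t x y + (if x = x0 \<and> y = y0 then e else 0)" for x y
    have "transport_plan R X Y m p t'"
      unfolding transport_plan_def
    proof (intro conjI ballI)
      fix y assume y: "y \<in> Y"
      have "(\<Sum>x\<in>X. t' x y) = (\<Sum>x\<in>X. t x y) + (\<Sum>x\<in>X. if x = x0 then (if y = y0 then e else 0) else 0)"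
        unfolding t'_def sum.distrib by (intro arg_cong2[where f="(+)"] sum.cong) auto
      also have "\<dots> = p y"
        using t y x0 fin by (simp add: transport_plan_def p'_def)
      finally show "(\<Sum>x\<in>X. t' x y) = p y" .
    next
      fix x assume x: "x \<in> X"
      have "(\<Sum>y\<in>Y. t' x y) = (\<Sum>y\<in>Y. t x y) + (\<Sum>y\<in>Y. if y = y0 then (if x = x0 then e else 0) else 0)"
        unfolding t'_def sum.distrib by (intro arg_cong2[where f="(+)"] sum.cong) auto
      also have "(\<Sum>y\<in>Y. t x y) \<le> m' x" using t x by (simp add: transport_plan_def)
      also have "m' x + (\<Sum>y\<in>Y. if y = y0 then (if x = x0 then e else 0) else 0) = m x"
        using y0 fin by (simp add: m'_def)
      finally show "(\<Sum>y\<in>Y. t' x y) \<le> m x" by simp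
    next
      fix x y assume "x \<in> X" "y \<in> Y"
      then show "0 \<le> t' x y" "t' x y \<noteq> 0 \<longrightarrow> R x y"
        using t e0 x0 by (auto simp: transport_plan_def t'_def)
    qed
    then show ?thesis by blast
  qed
qed

text \<open>The finite form of Strassen's theorem: if Hall's condition fails by at most \<open>\<delta>\<close>, some coupling
of \<open>m\<close> and \<open>p\<close> puts all but \<open>\<delta>\<close> of the mass on \<open>R\<close>. Adding one source of supply \<open>\<delta>\<close> that is
joined to every sink restores Hall's condition, and whatever the other sources ship in the resulting
plan respects \<open>R\<close>. The supplies and demands that remain are then coupled independently.\<close>

lemma finite_strassen:
  fixes m :: "'x \<Rightarrow> real" and p :: "'y \<Rightarrow> real"
  assumes fin: "finite X" "finite Y" and m: "\<forall>x\<in>X. 0 \<le> m x" and p: "\<forall>y\<in>Y. 0 \<le> p y"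
    and \<delta>: "0 \<le> \<delta>" and mass: "sum m X = sum p Y"
    and hall: "\<forall>F\<subseteq>Y. sum p F \<le> sum m {x\<in>X. \<exists>y\<in>F. R x y} + \<delta>"
  obtains c where "\<forall>x\<in>X. \<forall>y\<in>Y. 0 \<le> c x y" and "\<forall>x\<in>X. (\<Sum>y\<in>Y. c x y) = m x"
    and "\<forall>y\<in>Y. (\<Sum>x\<in>X. c x y) = p y"
    and "sum p Y - \<delta> \<le> (\<Sum>y\<in>Y. \<Sum>x\<in>{x\<in>X. R x y}. c x y)"
proof -
  let ?X = "insert None (Some ` X)"
  let ?R = "\<lambda>x y. case x of None \<Rightarrow> True | Some x \<Rightarrow> R x y"
  have "\<exists>t. transport_plan ?R ?X Y (case_option \<delta> m) p t"
  proof (rule transport_plan_exists)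
    show "\<forall>F\<subseteq>Y. sum p F \<le> sum (case_option \<delta> m) {x\<in>?X. \<exists>y\<in>F. ?R x y}"
    proof (intro allI impI)
      fix F assume F: "F \<subseteq> Y"
      show "sum p F \<le> sum (case_option \<delta> m) {x\<in>?X. \<exists>y\<in>F. ?R x y}"
      proof (cases "F = {}")
        case False
        then have "{x\<in>?X. \<exists>y\<in>F. ?R x y} = insert None (Some ` {x\<in>X. \<exists>y\<in>F. R x y})"
          by (auto simp: image_iff)
        then show ?thesis using hall[rule_format, OF F] fin by (simp add: sum.reindex add.commute)
      qed (auto intro!: sum_nonneg simp: m \<delta> split: option.split)
    qed
  qed (use fin m p \<delta> in auto)
  then obtain t0 where t0: "transport_plan ?R ?X Y (case_option \<delta> m) p t0" ..
  define t where "t x y = t0 (Some x) y" for x y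
  have t: "0 \<le> t x y" "t x y \<noteq> 0 \<Longrightarrow> R x y" if "x \<in> X" "y \<in> Y" for x y
    using t0 that unfolding transport_plan_def t_def by fastforce+
  have none: "0 \<le> t0 None y" if "y \<in> Y" for y
    using t0 that by (simp add: transport_plan_def)
  have row: "(\<Sum>y\<in>Y. t x y) \<le> m x" if "x \<in> X" for x
    using t0 that by (auto simp: transport_plan_def t_def)
  have col: "t0 None y + (\<Sum>x\<in>X. t x y) = p y" if "y \<in> Y" for y
    using t0 that fin by (simp add: transport_plan_def t_def sum.reindex)
  have dummy: "(\<Sum>y\<in>Y. t0 None y) \<le> \<delta>"
    using t0 by (simp add: transport_plan_def)
  define a where "a x = m x - (\<Sum>y\<in>Y. t x y)" for x
  define D where "D = (\<Sum>y\<in>Y. t0 None y)"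
  have D: "sum a X = D"
  proof -
    have "sum a X = sum p Y - (\<Sum>x\<in>X. \<Sum>y\<in>Y. t x y)" by (simp add: a_def sum_subtractf mass)
    also have "\<dots> = (\<Sum>y\<in>Y. p y - (\<Sum>x\<in>X. t x y))" 
      by (subst sum.swap) (simp add: sum_subtractf)
    also have "\<dots> = D" unfolding D_def by (intro sum.cong) (use col in \<open>auto simp: algebra_simps\<close>)
    finally show ?thesis .
  qed
  have a0: "0 \<le> a x" if "x \<in> X" for x using row that by (simp add: a_def)
  have D0: "0 \<le> D" unfolding D_def using none by (intro sum_nonneg)
  \<comment> \<open>If D = 0, nothing remains on either side, and the second summand is 0 by division by zero.\<close>
  define c where "c x y = t x y + a x * t0 None y / D" for x y
  have tc: "t x y \<le> c x y" if "x \<in> X" "y \<in> Y" for x y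
    using a0 D0 none that by (simp add: c_def)
  show thesis
  proof
    show "\<forall>x\<in>X. \<forall>y\<in>Y. 0 \<le> c x y" using tc t(1) by (meson order_trans)
    show "\<forall>x\<in>X. (\<Sum>y\<in>Y. c x y) = m x"
    proof
      fix x assume x: "x \<in> X"
      have "(\<Sum>y\<in>Y. c x y) = (\<Sum>y\<in>Y. t x y) + a x * D / D"
        by (simp add: c_def sum.distrib D_def flip: sum_distrib_left sum_divide_distrib)
      moreover have "a x = 0" if "D = 0"
        using D that a0 fin x by (simp add: sum_nonneg_eq_0_iff)
      ultimately show "(\<Sum>y\<in>Y. c x y) = m x" by (cases "D = 0") (auto simp: a_def)
    qed
    show "\<forall>y\<in>Y. (\<Sum>x\<in>X. c x y) = p y"
    proof
      fix y assume y: "y \<in> Y"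
      have "(\<Sum>x\<in>X. c x y) = (\<Sum>x\<in>X. t x y) + D * t0 None y / D"
        by (simp add: c_def sum.distrib flip: D sum_distrib_right sum_divide_distrib)
      moreover have "t0 None y = 0" if "D = 0"
        using that none fin y by (simp add: sum_nonneg_eq_0_iff D_def)
      ultimately show "(\<Sum>x\<in>X. c x y) = p y" using col[OF y] by (cases "D = 0") auto
    qed
    have "sum p Y - \<delta> \<le> (\<Sum>y\<in>Y. p y - t0 None y)" using dummy by (simp add: sum_subtractf)
    also have "\<dots> = (\<Sum>y\<in>Y. \<Sum>x\<in>X. t x y)" by (intro sum.cong) (use col in \<open>auto simp: algebra_simps\<close>)
    also have "\<dots> = (\<Sum>y\<in>Y. \<Sum>x\<in>{x\<in>X. R x y}. t x y)"
      using fin t by (intro sum.cong refl sum.mono_neutral_right) auto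
    also have "\<dots> \<le> (\<Sum>y\<in>Y. \<Sum>x\<in>{x\<in>X. R x y}. c x y)"
      using tc by (intro sum_mono) auto
    finally show "sum p Y - \<delta> \<le> (\<Sum>y\<in>Y. \<Sum>x\<in>{x\<in>X. R x y}. c x y)" .
  qed
qed

section \<open>Couplings with a finitely supported measure\<close>

lemma sets_restrict_borel_finite:
  fixes Y :: "'b::t1_space set"
  assumes "finite Y"
  shows "sets (restrict_space borel Y) = Pow Y"
proof -
  have "B \<in> sets borel" if "B \<subseteq> Y" for B
    using that assms by (intro borel_closed finite_imp_closed) (rule finite_subset)
  then show ?thesis by (auto simp: sets_restrict_space image_iff)
qed

text \<open>Since \<open>\<mu>\<close> lives on a finite set \<open>Y\<close>, whether \<open>x\<close> may be matched with \<open>y\<close> depends on \<open>x\<close> only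
through the set \<open>S x\<close> of the points of \<open>Y\<close> within \<open>\<delta>\<close> of \<open>x\<close>. Replacing \<open>x\<close> by \<open>S x\<close> leaves a
transport problem between \<open>Pow Y\<close> and \<open>Y\<close>, whose Hall condition is the hypothesis \<open>near\<close>. Its solution
\<open>c\<close> is spread over each class \<open>{x. S x = s}\<close> in proportion to \<open>\<upsilon>\<close>: given \<open>x\<close>, the second
coordinate is \<open>y\<close> with probability \<open>\<rho> (S x) y = c (S x) y / m (S x)\<close>.\<close>

lemma coupling_of_near:
  fixes \<upsilon> \<mu> :: "'b::metric_space measure"
  assumes \<upsilon>: "\<upsilon> \<in> space (prob_algebra borel)" and \<mu>: "\<mu> \<in> space (prob_algebra borel)"
    and fin: "finite Y" and conc: "measure \<mu> Y = 1" and \<delta>: "0 \<le> \<delta>"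
    and near: "\<And>F. F \<subseteq> Y \<Longrightarrow> measure \<mu> F \<le> measure \<upsilon> (\<Union>y\<in>F. cball y \<delta>) + \<delta>"
  obtains T where "T \<in> pos_measures (borel \<Otimes>\<^sub>M restrict_space borel Y)"
    and "distr T borel fst = \<upsilon>"
    and "distr T (restrict_space borel Y) snd = restrict_space \<mu> Y"
    and "1 - \<delta> \<le> measure T ({q. dist (fst q) (snd q) \<le> \<delta>} \<inter> space T)"
proof -
  interpret U: prob_space \<upsilon> using \<upsilon> by (simp add: space_prob_algebra)
  interpret M: prob_space \<mu> using \<mu> by (simp add: space_prob_algebra)
  have sets_\<upsilon> [simp, measurable_cong]: "sets \<upsilon> = sets borel" and sets_\<mu> [simp]: "sets \<mu> = sets borel"
    using \<upsilon> \<mu> by (simp_all add: space_prob_algebra)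
  then have space_\<upsilon> [simp]: "space \<upsilon> = UNIV" and space_\<mu> [simp]: "space \<mu> = UNIV"
    by (metis space_borel sets_eq_imp_space_eq)+
  have finB: "B \<in> sets borel" if "B \<subseteq> Y" for B :: "'b set"
    using that fin by (intro borel_closed finite_imp_closed) (rule finite_subset)
  define S where "S x = {y\<in>Y. dist x y \<le> \<delta>}" for x
  have SY: "S x \<in> Pow Y" for x by (auto simp: S_def)
  define A where "A s = S -` {s}" for s
  have A [measurable]: "A s \<in> sets borel" if "s \<in> Pow Y" for s
  proof -
    have "A s = (\<Inter>y\<in>s. cball y \<delta>) \<inter> (\<Inter>y\<in>Y - s. - cball y \<delta>)"
      using that by (auto simp: A_def S_def dist_commute)
    moreover have "closed (\<Inter>y\<in>s. cball y \<delta>)" by (intro closed_INT) auto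
    moreover have "open (\<Inter>y\<in>Y - s. - cball y \<delta>)" using fin by (intro open_INT) auto
    ultimately show ?thesis by (simp add: borel_closed borel_open sets.Int)
  qed
  have S_meas [measurable]: "S \<in> borel \<rightarrow>\<^sub>M count_space (Pow Y)"
    using SY fin A by (subst measurable_count_space_eq2) (auto simp: A_def)
  have disj: "disjoint_family_on A I" for I by (auto simp: disjoint_family_on_def A_def)
  define m where "m s = measure \<upsilon> (A s)" for s
  define p where "p y = measure \<mu> {y}" for y
  have sum_m: "sum m {s \<in> Pow Y. \<exists>y\<in>F. y \<in> s} = measure \<upsilon> (\<Union>y\<in>F. cball y \<delta>)" if "F \<subseteq> Y" for F
  proof -
    have "measure \<upsilon> (\<Union>s\<in>{s \<in> Pow Y. \<exists>y\<in>F. y \<in> s}. A s) = sum m {s \<in> Pow Y. \<exists>y\<in>F. y \<in> s}"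
      unfolding m_def using fin
      by (intro U.finite_measure_finite_Union disj) auto
    also have "(\<Union>s\<in>{s \<in> Pow Y. \<exists>y\<in>F. y \<in> s}. A s) = (\<Union>y\<in>F. cball y \<delta>)"
    proof (intro equalityI subsetI)
      fix x assume "x \<in> (\<Union>y\<in>F. cball y \<delta>)"
      then obtain y where y: "y \<in> F" "dist x y \<le> \<delta>" by (auto simp: dist_commute)
      then have "y \<in> S x" using that by (auto simp: S_def)
      then show "x \<in> (\<Union>s\<in>{s \<in> Pow Y. \<exists>y\<in>F. y \<in> s}. A s)"
        using y SY[of x] by (intro UN_I[of "S x"]) (auto simp: A_def)
    qed (auto simp: A_def S_def dist_commute)
    finally show ?thesis by simp
  qed
  have sum_m_Y: "sum m (Pow Y) = 1"
  proof -
    have "measure \<upsilon> (\<Union>s\<in>Pow Y. A s) = sum m (Pow Y)"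
      unfolding m_def using fin
      by (intro U.finite_measure_finite_Union disj) auto
    moreover have "(\<Union>s\<in>Pow Y. A s) = UNIV" using SY by (auto simp: A_def)
    ultimately show ?thesis using U.prob_space by simp
  qed
  have sum_p: "sum p F = measure \<mu> F" if "F \<subseteq> Y" for F
    unfolding p_def using that fin finB
    by (intro M.finite_measure_eq_sum_singleton[symmetric]) (auto intro: finite_subset)
  have "\<forall>F\<subseteq>Y. sum p F \<le> sum m {s \<in> Pow Y. \<exists>y\<in>F. y \<in> s} + \<delta>"
    by (intro allI impI) (simp only: sum_m sum_p near)
  then obtain c where c0: "\<forall>s\<in>Pow Y. \<forall>y\<in>Y. 0 \<le> c s y"
      and c_row: "\<forall>s\<in>Pow Y. (\<Sum>y\<in>Y. c s y) = m s"
      and c_col: "\<forall>y\<in>Y. (\<Sum>s\<in>Pow Y. c s y) = p y"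
      and c_near: "sum p Y - \<delta> \<le> (\<Sum>y\<in>Y. \<Sum>s\<in>{s\<in>Pow Y. y \<in> s}. c s y)"
    using finite_strassen[of "Pow Y" Y m p \<delta> "\<lambda>s y. y \<in> s"] fin \<delta>
    by (auto simp: m_def p_def sum_m_Y[unfolded m_def] sum_p[unfolded p_def] conc)
  have c_m0: "c s y = 0" if "s \<in> Pow Y" "y \<in> Y" "m s = 0" for s y
  proof -
    have "(\<Sum>y\<in>Y. c s y) = 0" using c_row that by auto
    then show ?thesis using that c0 fin by (subst (asm) sum_nonneg_eq_0_iff) auto
  qed
  define \<rho> where "\<rho> s y = c s y / m s" for s y
  have \<rho>0: "0 \<le> \<rho> s y" if "s \<in> Pow Y" "y \<in> Y" for s y
    using that c0 by (simp add: \<rho>_def m_def)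
  have \<rho>m: "\<rho> s y * m s = c s y" if "s \<in> Pow Y" "y \<in> Y" for s y
    using c_m0[OF that] by (simp add: \<rho>_def)
  \<comment> \<open>The conditional probabilities add up to 1 except on the classes of mass 0.\<close>
  have "AE x in \<upsilon>. \<forall>s\<in>Pow Y. m s = 0 \<longrightarrow> x \<notin> A s"
    using fin
    by (subst AE_finite_all) (auto simp: m_def U.emeasure_eq_measure intro!: AE_not_in null_setsI)
  then have \<rho>_sum: "AE x in \<upsilon>. (\<Sum>y\<in>Y. \<rho> (S x) y) = 1"
  proof eventually_elim
    case (elim x)
    then have "m (S x) \<noteq> 0" using SY[of x] by (auto simp: A_def)
    then show ?case using c_row SY[of x] by (simp add: \<rho>_def flip: sum_divide_distrib)
  qed
  have int_S: "(\<integral>\<^sup>+x. ennreal (h (S x)) \<partial>\<upsilon>) = ennreal (\<Sum>s\<in>Pow Y. h s * m s)"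
    if h: "\<And>s. s \<in> Pow Y \<Longrightarrow> 0 \<le> h s" for h
  proof -
    have "ennreal (h (S x)) = (\<Sum>s\<in>Pow Y. ennreal (h s) * indicator (A s) x)" for x
      using fin SY[of x] by (simp add: indicator_def A_def)
    then have "(\<integral>\<^sup>+x. ennreal (h (S x)) \<partial>\<upsilon>) = (\<Sum>s\<in>Pow Y. ennreal (h s) * emeasure \<upsilon> (A s))"
      by (simp add: nn_integral_sum nn_integral_cmult_indicator)
    also have "\<dots> = (\<Sum>s\<in>Pow Y. ennreal (h s * m s))"
      using h by (intro sum.cong) (auto simp: m_def U.emeasure_eq_measure ennreal_mult)
    also have "\<dots> = ennreal (\<Sum>s\<in>Pow Y. h s * m s)"
      using h by (intro sum_ennreal) (auto simp: m_def)
    finally show ?thesis .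
  qed
  let ?C = "count_space Y"
  have sets_C: "sets (restrict_space borel Y) = sets ?C"
    using sets_restrict_borel_finite[OF fin] by simp
  have sets_prod: "sets (\<upsilon> \<Otimes>\<^sub>M ?C) = sets (borel \<Otimes>\<^sub>M restrict_space borel Y)"
    using sets_C by (intro sets_pair_measure_cong) auto
  interpret C: sigma_finite_measure ?C
    using fin by (intro sigma_finite_measure_count_space_finite)
  have \<rho>_meas [measurable]: "(\<lambda>q. ennreal (\<rho> (S (fst q)) (snd q))) \<in> borel_measurable (\<upsilon> \<Otimes>\<^sub>M ?C)"
  proof -
    have "(\<lambda>q. (S (fst q), snd q)) \<in> \<upsilon> \<Otimes>\<^sub>M ?C \<rightarrow>\<^sub>M count_space (Pow Y) \<Otimes>\<^sub>M ?C"
      by measurable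
    also have "count_space (Pow Y) \<Otimes>\<^sub>M ?C = count_space (Pow Y \<times> Y)"
      using fin by (intro pair_measure_count_space) auto
    finally have "(\<lambda>q. (S (fst q), snd q)) \<in> \<upsilon> \<Otimes>\<^sub>M ?C \<rightarrow>\<^sub>M count_space (Pow Y \<times> Y)" .
    from measurable_compose[OF this, of "\<lambda>(s, y). ennreal (\<rho> s y)" borel]
    show ?thesis by simp
  qed
  define T where "T = density (\<upsilon> \<Otimes>\<^sub>M ?C) (\<lambda>q. ennreal (\<rho> (S (fst q)) (snd q)))"
  have sets_T: "sets T = sets (borel \<Otimes>\<^sub>M restrict_space borel Y)" by (simp add: T_def sets_prod)
  have space_T: "space T = UNIV \<times> Y" by (simp add: T_def space_pair_measure)
  have emT: "emeasure T B = (\<integral>\<^sup>+x. (\<Sum>y\<in>Y. ennreal (\<rho> (S x) y) * indicator B (x, y)) \<partial>\<upsilon>)"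
    if B: "B \<in> sets T" for B
  proof -
    have [measurable]: "B \<in> sets (\<upsilon> \<Otimes>\<^sub>M ?C)" using B by (simp add: T_def)
    have "emeasure T B = (\<integral>\<^sup>+q. ennreal (\<rho> (S (fst q)) (snd q)) * indicator B q \<partial>(\<upsilon> \<Otimes>\<^sub>M ?C))"
      unfolding T_def by (intro emeasure_density) measurable
    also have "\<dots> = (\<integral>\<^sup>+x. (\<integral>\<^sup>+y. ennreal (\<rho> (S x) y) * indicator B (x, y) \<partial>?C) \<partial>\<upsilon>)"
      by (subst C.nn_integral_fst[symmetric]) auto
    finally show ?thesis using fin by (simp add: nn_integral_count_space_finite)
  qed
  have fst_T [measurable]: "fst \<in> T \<rightarrow>\<^sub>M borel"
    unfolding T_def by measurable
  have snd_T: "snd \<in> T \<rightarrow>\<^sub>M restrict_space borel Y"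
  proof -
    have "snd \<in> T \<rightarrow>\<^sub>M ?C" unfolding T_def by measurable
    then show ?thesis using measurable_cong_sets[OF refl sets_C, of T] by simp
  qed
  show thesis
  proof
    show "T \<in> pos_measures (borel \<Otimes>\<^sub>M restrict_space borel Y)"
      by (simp add: pos_measures_def sets_T)
    show "distr T borel fst = \<upsilon>"
    proof (rule measure_eqI)
      fix B assume "B \<in> sets (distr T borel fst)"
      then have B [measurable]: "B \<in> sets borel" by simp
      have "emeasure (distr T borel fst) B = emeasure T (fst -` B \<inter> space T)"
        by (intro emeasure_distr) auto
      also have "\<dots> = (\<integral>\<^sup>+x. (\<Sum>y\<in>Y. ennreal (\<rho> (S x) y)) * indicator B x \<partial>\<upsilon>)"
        using measurable_sets[OF fst_T B]
        by (subst emT)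
           (auto simp: space_T indicator_def sum_distrib_right intro!: nn_integral_cong sum.cong)
      also have "\<dots> = (\<integral>\<^sup>+x. indicator B x \<partial>\<upsilon>)"
      proof (rule nn_integral_cong_AE, use \<rho>_sum in eventually_elim)
        case (elim x)
        then show ?case using \<rho>0 SY[of x] by (simp add: sum_ennreal)
      qed
      finally show "emeasure (distr T borel fst) B = emeasure \<upsilon> B" by simp
    qed simp
    show "distr T (restrict_space borel Y) snd = restrict_space \<mu> Y"
    proof (rule measure_eqI_finite[where A=Y])
      show "sets (distr T (restrict_space borel Y) snd) = Pow Y"
        using sets_restrict_borel_finite[OF fin] by simp
      show "sets (restrict_space \<mu> Y) = Pow Y"
        using sets_restrict_borel_finite[OF fin] by (metis sets_restrict_space_cong sets_\<mu>)
      fix y assume y: "y \<in> Y"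
      have y_sets: "{y} \<in> sets (restrict_space borel Y)"
        using sets_restrict_borel_finite[OF fin] y by simp
      have "emeasure (distr T (restrict_space borel Y) snd) {y} = emeasure T (snd -` {y} \<inter> space T)"
        by (intro emeasure_distr snd_T y_sets)
      also have "\<dots> = (\<integral>\<^sup>+x. (\<Sum>y'\<in>Y. ennreal (\<rho> (S x) y') * indicator {y} y') \<partial>\<upsilon>)"
        using measurable_sets[OF snd_T y_sets]
        by (subst emT) (auto simp: space_T indicator_def intro!: nn_integral_cong sum.cong)
      also have "\<dots> = (\<integral>\<^sup>+x. ennreal (\<rho> (S x) y) \<partial>\<upsilon>)"
        using fin y by (simp add: indicator_def)
      also have "\<dots> = ennreal (p y)"
        using y c_col \<rho>0 by (subst int_S) (auto simp: \<rho>m)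
      also have "\<dots> = emeasure (restrict_space \<mu> Y) {y}"
        using y finB[of Y] by (subst emeasure_restrict_space) (auto simp: p_def M.emeasure_eq_measure)
      finally show "emeasure (distr T (restrict_space borel Y) snd) {y} = emeasure (restrict_space \<mu> Y) {y}" .
    qed (use fin in auto)
    let ?D = "{q. dist (fst q) (snd q) \<le> \<delta>} \<inter> space T"
    have "?D = (\<Union>y\<in>Y. cball y \<delta> \<times> {y})" by (auto simp: space_T dist_commute)
    moreover have "cball y \<delta> \<times> {y} \<in> sets T" if "y \<in> Y" for y
      using that by (simp add: T_def)
    ultimately have D: "?D \<in> sets T" using fin by (auto intro!: sets.finite_UN)
    have "emeasure T ?D = (\<integral>\<^sup>+x. (\<Sum>y\<in>Y. ennreal (\<rho> (S x) y * indicator (S x) y)) \<partial>\<upsilon>)"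
      by (subst emT[OF D]) (auto simp: space_T S_def indicator_def intro!: nn_integral_cong sum.cong)
    also have "\<dots> = (\<integral>\<^sup>+x. ennreal (\<Sum>y\<in>Y. \<rho> (S x) y * indicator (S x) y) \<partial>\<upsilon>)"
      using \<rho>0 SY by (intro nn_integral_cong sum_ennreal) auto
    also have "\<dots> = ennreal (\<Sum>s\<in>Pow Y. (\<Sum>y\<in>Y. \<rho> s y * indicator s y) * m s)"
      using \<rho>0 by (intro int_S sum_nonneg) auto
    also have "(\<Sum>s\<in>Pow Y. (\<Sum>y\<in>Y. \<rho> s y * indicator s y) * m s)
        = (\<Sum>s\<in>Pow Y. \<Sum>y\<in>Y. if y \<in> s then c s y else 0)"
      using \<rho>m by (auto simp: sum_distrib_right indicator_def intro!: sum.cong)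
    also have "\<dots> = (\<Sum>y\<in>Y. \<Sum>s\<in>{s\<in>Pow Y. y \<in> s}. c s y)"
      using fin by (subst sum.swap, intro sum.cong refl sum.inter_filter[symmetric]) simp
    finally have eq: "emeasure T ?D = ennreal (\<Sum>y\<in>Y. \<Sum>s\<in>{s\<in>Pow Y. y \<in> s}. c s y)" .
    have "0 \<le> (\<Sum>y\<in>Y. \<Sum>s\<in>{s\<in>Pow Y. y \<in> s}. c s y)" using c0 by (intro sum_nonneg) auto
    then have "measure T ?D = (\<Sum>y\<in>Y. \<Sum>s\<in>{s\<in>Pow Y. y \<in> s}. c s y)"
      using eq by (simp add: measure_def)
    moreover have "sum p Y = 1" using sum_p[OF order_refl] conc by simp
    ultimately show "1 - \<delta> \<le> measure T ?D" using c_near by linarith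
  qed
qed

text \<open>The easy half of Strassen's theorem: if the second coordinate lies in \<open>B\<close>, then the first one
lies in \<open>C\<close> or the two are more than \<open>\<delta>\<close> apart. The second marginal forces \<open>T\<close>, and hence its
first marginal, to have total mass 1.\<close>

lemma near_of_coupling:
  fixes \<mu> :: "'b::metric_space measure"
  assumes \<mu>: "\<mu> \<in> space (prob_algebra borel)" and fin: "finite Y" and conc: "measure \<mu> Y = 1"
    and T: "T \<in> pos_measures (borel \<Otimes>\<^sub>M restrict_space borel Y)"
    and snd: "distr T (restrict_space borel Y) snd = restrict_space \<mu> Y"
    and close: "1 - \<delta> \<le> measure T ({q. dist (fst q) (snd q) \<le> \<delta>} \<inter> space T)"
  shows "distr T borel fst \<in> space (prob_algebra borel)"
    and "\<And>B C. \<lbrakk>B \<in> sets borel; C \<in> sets borel; (\<Union>x\<in>B. cball x \<delta>) \<subseteq> C\<rbrakk> \<Longrightarrow>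
      measure \<mu> B \<le> measure (distr T borel fst) C + \<delta>"
proof -
  interpret M: prob_space \<mu> using \<mu> by (simp add: space_prob_algebra)
  have sets_\<mu> [simp]: "sets \<mu> = sets borel" using \<mu> by (simp_all add: space_prob_algebra)
  then have space_\<mu> [simp]: "space \<mu> = UNIV" by (metis space_borel sets_eq_imp_space_eq)
  have sets_T [measurable_cong]: "sets T = sets (borel \<Otimes>\<^sub>M restrict_space borel Y)"
    using T by (simp add: pos_measures_def)
  then have space_T: "space T = UNIV \<times> Y"
    by (simp add: sets_eq_imp_space_eq space_pair_measure space_restrict_space)
  have fst_T [measurable]: "fst \<in> T \<rightarrow>\<^sub>M borel" by measurable
  have snd_T [measurable]: "snd \<in> T \<rightarrow>\<^sub>M restrict_space borel Y" by measurable
  have Y: "Y \<in> sets borel" using fin by (intro borel_closed finite_imp_closed)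
  have "emeasure T (space T) = emeasure (distr T (restrict_space borel Y) snd) Y"
    using Y by (subst emeasure_distr) (auto simp: space_T sets_restrict_space image_iff intro!: arg_cong[where f="emeasure T"])
  also have "\<dots> = 1"
    unfolding snd using Y conc by (subst emeasure_restrict_space) (auto simp: M.emeasure_eq_measure)
  finally interpret T: prob_space T by (rule prob_spaceI)
  show "distr T borel fst \<in> space (prob_algebra borel)"
    by (simp add: space_prob_algebra T.prob_space_distr)
  fix B C :: "'b set"
  assume B: "B \<in> sets borel" and C [measurable]: "C \<in> sets borel" and BC: "(\<Union>x\<in>B. cball x \<delta>) \<subseteq> C"
  let ?D = "{q. dist (fst q) (snd q) \<le> \<delta>} \<inter> space T"
  have "?D = (\<Union>y\<in>Y. cball y \<delta> \<times> {y})" by (auto simp: space_T dist_commute)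
  moreover have "cball y \<delta> \<times> {y} \<in> sets T" if "y \<in> Y" for y
    using that sets_restrict_borel_finite[OF fin] unfolding sets_T by (intro pair_measureI) auto
  ultimately have D: "?D \<in> sets T" using fin by (auto intro!: sets.finite_UN)
  have BY: "B \<inter> Y \<in> sets (restrict_space borel Y)" using B by (auto simp: sets_restrict_space)
  have "measure \<mu> (- Y) = 0" using M.prob_compl[of Y] Y conc by (simp add: Compl_eq_Diff_UNIV)
  moreover have "measure \<mu> B \<le> measure \<mu> (B \<inter> Y) + measure \<mu> (- Y)"
    using B Y by (intro order_trans[OF M.finite_measure_mono measure_Un_le]) auto
  ultimately have "measure \<mu> B \<le> measure \<mu> (B \<inter> Y)" by simp
  also have "measure \<mu> (B \<inter> Y) = measure (distr T (restrict_space borel Y) snd) (B \<inter> Y)"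
    unfolding snd using Y by (subst measure_restrict_space) auto
  also have "\<dots> = measure T (snd -` (B \<inter> Y) \<inter> space T)"
    by (intro measure_distr snd_T BY)
  also have "\<dots> \<le> measure T ((fst -` C \<inter> space T) \<union> (space T - ?D))"
  proof (intro T.finite_measure_mono)
    have "a \<in> C" if "b \<in> B" "dist a b \<le> \<delta>" for a b
    proof -
      have "a \<in> cball b \<delta>" using that by (simp add: dist_commute)
      then show ?thesis using BC that by blast
    qed
    then show "snd -` (B \<inter> Y) \<inter> space T \<subseteq> (fst -` C \<inter> space T) \<union> (space T - ?D)" by auto
  qed (use D measurable_sets[OF fst_T C] in auto)
  also have "\<dots> \<le> measure T (fst -` C \<inter> space T) + measure T (space T - ?D)"
    using D measurable_sets[OF fst_T C] by (intro measure_Un_le) auto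
  also have "measure T (space T - ?D) = 1 - measure T ?D" by (rule T.prob_compl[OF D])
  also have "measure T (fst -` C \<inter> space T) = measure (distr T borel fst) C"
    by (simp add: measure_distr)
  finally show "measure \<mu> B \<le> measure (distr T borel fst) C + \<delta>" using close by simp
qed

section \<open>Relative entropy of densities\<close>

text \<open>For a probability density \<open>f\<close> the affine part of \<open>entropy_fun (f x)\<close> integrates to 0, so it
does not change the relative entropy; it makes the integrand nonnegative, so that all integrals exist
and Fatou's lemma applies. As \<open>0 * ln 0 = 0\<close>, the value at 0 is the continuous one.\<close>

definition entropy_fun :: "real \<Rightarrow> real" where
  "entropy_fun x = x * ln x - x + 1"

lemma entropy_fun_measurable [measurable]: "entropy_fun \<in> borel_measurable borel"
  unfolding entropy_fun_def by measurable

lemma entropy_fun_nonneg: "0 \<le> entropy_fun x" if "0 \<le> x"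
proof (cases "x = 0")
  case False
  then have "0 < x" using that by simp
  then have "ln (1 / x) \<le> 1 / x - 1" by (intro ln_le_minus_one) simp
  then have "x * - ln x \<le> x * (1 / x - 1)"
    using \<open>0 < x\<close> by (intro mult_left_mono) (auto simp: ln_div)
  then show ?thesis using \<open>0 < x\<close> by (simp add: entropy_fun_def algebra_simps)
qed (simp add: entropy_fun_def)

lemma continuous_on_entropy_fun: "continuous_on {0..} entropy_fun"
proof -
  have greaterThan_0_eq: "{0..} - {0} = {(0::real)<..}" by auto
  have "((\<lambda>x. x * ln x) \<longlongrightarrow> 0) (at_right (0::real))" by real_asymp
  then have "((\<lambda>x. x * ln x - x + 1) \<longlongrightarrow> 0 - 0 + 1) (at_right (0::real))"
    by (intro tendsto_intros)
  then have "(entropy_fun \<longlongrightarrow> entropy_fun 0) (at 0 within {0..})"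
    by (simp add: entropy_fun_def[abs_def] at_within_def
        greaterThan_0_eq)
  moreover have "isCont entropy_fun x" if "0 < x" for x
    unfolding entropy_fun_def[abs_def] using that by (intro continuous_intros) auto
  ultimately show ?thesis
    unfolding continuous_on_eq_continuous_within continuous_within
    by (metis atLeast_iff continuous_at_imp_continuous_at_within continuous_within less_eq_real_def)
qed

text \<open>The Hellinger lower bound for relative entropy, pointwise. It is \<open>ln t \<le> t - 1\<close> at
\<open>t = sqrt m / sqrt a\<close>.\<close>

lemma sq_sqrt_diff_le:
  fixes a m :: real
  assumes "0 \<le> a" "0 \<le> m" "m = 0 \<Longrightarrow> a = 0"
  shows "(sqrt a - sqrt m)\<^sup>2 \<le> a * (ln a - ln m) - a + m"
proof (cases "a = 0")
  case False
  then have pos: "0 < a" "0 < m" using assms by (auto simp: less_le)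
  have "ln (sqrt m / sqrt a) \<le> sqrt m / sqrt a - 1"
    using pos by (intro ln_le_minus_one) simp
  then have "ln m - ln a \<le> 2 * (sqrt m / sqrt a - 1)"
    using pos by (simp add: ln_div ln_sqrt)
  then have "a * (ln m - ln a) \<le> a * (2 * (sqrt m / sqrt a - 1))"
    using pos by (intro mult_left_mono) auto
  also have "\<dots> = 2 * (a / sqrt a * sqrt m) - 2 * a"
    using pos by (simp add: algebra_simps)
  also have "a / sqrt a = sqrt a" using pos by (simp add: real_div_sqrt)
  finally have "a * (ln m - ln a) \<le> 2 * (sqrt a * sqrt m) - 2 * a" .
  then show ?thesis using pos by (simp add: power2_diff algebra_simps)
qed (use assms in simp)

text \<open>A quantitative form of strict convexity at the midpoint \<open>m\<close>: the gap is the sum of the relative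
entropies of \<open>a\<close> and \<open>b\<close> with respect to \<open>m\<close>. Each of them dominates a squared Hellinger distance,
and these add up by the parallelogram inequality.\<close>

lemma entropy_gap:
  fixes a b :: real
  assumes a: "0 \<le> a" and b: "0 \<le> b"
  shows "(sqrt a - sqrt b)\<^sup>2 / 2
    \<le> entropy_fun a + entropy_fun b - 2 * entropy_fun ((a + b) / 2)"
proof -
  let ?m = "(a + b) / 2"
  define p q c where "p = sqrt a" and "q = sqrt b" and "c = sqrt ?m"
  have "(p - q)\<^sup>2 / 2 \<le> (p - c)\<^sup>2 + (q - c)\<^sup>2"
  proof -
    have "(p - c)\<^sup>2 + (q - c)\<^sup>2 - (p - q)\<^sup>2 / 2 = (p + q - 2 * c)\<^sup>2 / 2"
      by (simp add: power2_eq_square field_simps)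
    then show ?thesis using zero_le_power2[of "p + q - 2 * c"] by linarith
  qed
  also have "\<dots> \<le> (a * (ln a - ln ?m) - a + ?m) + (b * (ln b - ln ?m) - b + ?m)"
    unfolding p_def q_def c_def using a b by (intro add_mono sq_sqrt_diff_le) auto
  also have "\<dots> = a * ln a + b * ln b - (a + b) * ln ?m"
    by (simp add: algebra_simps)
  also have "\<dots> = entropy_fun a + entropy_fun b - 2 * entropy_fun ?m"
    by (simp add: entropy_fun_def field_simps)
  finally show ?thesis by (simp add: p_def q_def)
qed

text \<open>A pointwise version of Pinsker's inequality, from
\<open>\<bar>a - b\<bar> = \<bar>sqrt a - sqrt b\<bar> * (sqrt a + sqrt b)\<close>. The product is split by the weighted
arithmetic-geometric mean inequality, so that the estimate can be integrated term by term.\<close>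

lemma abs_diff_le_entropy_gap:
  fixes a b e :: real
  assumes a: "0 \<le> a" and b: "0 \<le> b" and e: "0 < e"
  shows "\<bar>a - b\<bar> \<le> (entropy_fun a + entropy_fun b - 2 * entropy_fun ((a + b) / 2)) / e + e * (a + b)"
proof -
  define p q where "p = sqrt a" and "q = sqrt b"
  have sq: "p\<^sup>2 = a" "q\<^sup>2 = b" and nn: "0 \<le> p" "0 \<le> q" using a b by (auto simp: p_def q_def)
  have "\<bar>a - b\<bar> = \<bar>p - q\<bar> * (p + q)"
  proof -
    have "a - b = (p - q) * (p + q)" unfolding sq[symmetric] by (simp add: power2_eq_square algebra_simps)
    then show ?thesis using nn by (simp add: abs_mult)
  qed
  also have "\<dots> \<le> (p - q)\<^sup>2 / (2 * e) + e * (p + q)\<^sup>2 / 2"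
  proof -
    have "0 \<le> (\<bar>p - q\<bar> - e * (p + q))\<^sup>2 / (2 * e)" using e by simp
    also have "\<dots> = (p - q)\<^sup>2 / (2 * e) + e * (p + q)\<^sup>2 / 2 - \<bar>p - q\<bar> * (p + q)"
      using e by (simp add: power2_diff power_mult_distrib add_divide_distrib diff_divide_distrib)
        (simp add: power2_eq_square)
    finally show ?thesis by simp
  qed
  also have "\<dots> \<le> ((p - q)\<^sup>2 / 2) / e + e * (a + b)"
  proof -
    have "(p + q)\<^sup>2 / 2 \<le> a + b"
      using zero_le_power2[of "p - q"] unfolding sq[symmetric] by (simp add: power2_eq_square algebra_simps)
    then have "e * ((p + q)\<^sup>2 / 2) \<le> e * (a + b)" using e by (intro mult_left_mono) auto
    then show ?thesis by simp
  qed
  also have "(p - q)\<^sup>2 / 2 / e \<le> (entropy_fun a + entropy_fun b - 2 * entropy_fun ((a + b) / 2)) / e"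
    using entropy_gap[OF a b] e unfolding p_def q_def by (intro divide_right_mono) auto
  finally show ?thesis by simp
qed

text \<open>The relative entropy is a difference of two integrals, of which the negative one is at most 1 by
\<open>- x * ln x \<le> 1 - x\<close>. It can therefore be moved to the other side, and the claim becomes an identity of
nonnegative integrands.\<close>

lemma KL_density_eq:
  assumes \<nu>: "prob_space \<nu>" and f [measurable]: "f \<in> borel_measurable \<nu>"
    and nn: "\<And>x. 0 \<le> f x" and one: "(\<integral>\<^sup>+x. ennreal (f x) \<partial>\<nu>) = 1"
  shows "KL (density \<nu> (\<lambda>x. ennreal (f x))) \<nu> = enn2ereal (\<integral>\<^sup>+x. ennreal (entropy_fun (f x)) \<partial>\<nu>)"
proof -
  interpret prob_space \<nu> by fact
  let ?\<mu> = "density \<nu> (\<lambda>x. ennreal (f x))"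
  have ac: "absolutely_continuous \<nu> ?\<mu>" by (rule absolutely_continuousI_density) measurable
  have RN: "AE x in \<nu>. ennreal (f x) = RN_deriv \<nu> ?\<mu> x"
    by (rule RN_deriv_unique) auto
  define Pos where "Pos = (\<integral>\<^sup>+x. ennreal (f x) * ennreal (ln (f x)) \<partial>\<nu>)"
  define Neg where "Neg = (\<integral>\<^sup>+x. ennreal (f x) * ennreal (- ln (f x)) \<partial>\<nu>)"
  define Ent where "Ent = (\<integral>\<^sup>+x. ennreal (entropy_fun (f x)) \<partial>\<nu>)"
  have RN': "AE x in \<nu>. enn2real (RN_deriv \<nu> ?\<mu> x) = f x"
    using RN by eventually_elim (metis enn2real_ennreal nn)
  have "(\<integral>\<^sup>+x. ennreal (ln (enn2real (RN_deriv \<nu> ?\<mu> x))) \<partial>?\<mu>) = Pos"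
    unfolding Pos_def
    by (subst nn_integral_density) (auto intro!: nn_integral_cong_AE eventually_mono[OF RN'])
  moreover have "(\<integral>\<^sup>+x. ennreal (- ln (enn2real (RN_deriv \<nu> ?\<mu> x))) \<partial>?\<mu>) = Neg"
    unfolding Neg_def
    by (subst nn_integral_density) (auto intro!: nn_integral_cong_AE eventually_mono[OF RN'])
  moreover have "emeasure ?\<mu> (space ?\<mu>) = 1"
    using one by (simp add: emeasure_density cong: nn_integral_cong)
  ultimately have KL: "KL ?\<mu> \<nu> = enn2ereal Pos - enn2ereal Neg - 1 + 1"
    using ac by (simp add: KL_def ext_integral_def emeasure_space_1 one_ennreal.rep_eq)
  have pt: "ennreal (f x) * ennreal (ln (f x)) + 1
      = ennreal (entropy_fun (f x)) + ennreal (f x) * ennreal (- ln (f x)) + ennreal (f x)" for x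
  proof -
    have *: "ennreal (f x) * ennreal c = ennreal (f x * c)" for c using nn by (simp add: ennreal_mult')
    show ?thesis
    proof (cases "0 \<le> ln (f x)")
      case True
      then have "ennreal (f x * ln (f x)) + 1 = ennreal (f x * ln (f x) + 1)"
        using nn by (subst ennreal_plus) auto
      also have "\<dots> = ennreal (entropy_fun (f x) + f x)" by (simp add: entropy_fun_def)
      also have "\<dots> = ennreal (entropy_fun (f x)) + ennreal (f x)"
        using nn entropy_fun_nonneg by (intro ennreal_plus) auto
      finally show ?thesis using True by (simp add: * ennreal_neg)
    next
      case False
      have "1 = ennreal (entropy_fun (f x) + f x * - ln (f x) + f x)"
        by (simp add: entropy_fun_def)
      also have "\<dots> = ennreal (entropy_fun (f x) + f x * - ln (f x)) + ennreal (f x)"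
        using nn entropy_fun_nonneg[OF nn] False 
        by (intro ennreal_plus add_nonneg_nonneg mult_nonneg_nonneg) auto
      also have "ennreal (entropy_fun (f x) + f x * - ln (f x))
          = ennreal (entropy_fun (f x)) + ennreal (f x * - ln (f x))"
        using nn entropy_fun_nonneg[OF nn] False by (intro ennreal_plus mult_nonneg_nonneg) auto
      finally show ?thesis using False by (simp add: * ennreal_neg)
    qed
  qed
  have "Pos + 1 = (\<integral>\<^sup>+x. ennreal (f x) * ennreal (ln (f x)) + 1 \<partial>\<nu>)"
    unfolding Pos_def by (subst nn_integral_add) (auto simp: emeasure_space_1)
  also have "\<dots> = Ent + Neg + 1"
    unfolding pt Ent_def Neg_def by (subst nn_integral_add; simp?)+ (simp add: one)
  finally have eq: "Pos + 1 = Ent + Neg + 1" .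
  have "Neg \<le> (\<integral>\<^sup>+x. 1 \<partial>\<nu>)"
    unfolding Neg_def
  proof (intro nn_integral_mono)
    fix x
    have "f x * - ln (f x) \<le> 1"
      using entropy_fun_nonneg[OF nn[of x]] nn[of x] by (simp add: entropy_fun_def)
    then show "ennreal (f x) * ennreal (- ln (f x)) \<le> 1"
      using nn by (simp flip: ennreal_mult')
  qed
  then have "Neg \<le> 1" by (simp add: emeasure_space_1)
  then obtain n where n: "0 \<le> n" "Neg = ennreal n" by (cases Neg) (auto simp: top_unique)
  have "enn2ereal Pos - enn2ereal Neg - 1 + 1 = enn2ereal Ent"
  proof (cases Ent)
    case (real c)
    then have "Pos + 1 = ennreal (c + n + 1)" using eq n by (simp flip: ennreal_1)
    then have "Pos = ennreal (c + n)"
      using real n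
      by (cases Pos) (auto simp flip: ennreal_1 ennreal_plus simp del: ennreal_1)
    then have "enn2ereal Pos = ereal (c + n)" using real n by (simp del: ennreal_plus)
    then show ?thesis using real n by (simp add: one_ereal_def)
  next
    case top
    then have "Pos = top" using eq n by (cases Pos) (auto simp flip: ennreal_1 ennreal_plus simp del: ennreal_1)
    then show ?thesis using top n by (simp add: one_ereal_def)
  qed
  then show ?thesis using KL by (simp add: Ent_def)
qed

lemma nn_integral_le_AE_limit:
  fixes g :: "nat \<Rightarrow> 'a \<Rightarrow> real"
  assumes [measurable]: "\<And>i. g i \<in> borel_measurable M"
    and lim: "AE x in M. (\<lambda>i. g i x) \<longlonglongrightarrow> h x"
    and bound: "\<forall>\<^sub>F i in sequentially. (\<integral>\<^sup>+x. ennreal (g i x) \<partial>M) \<le> C"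
  shows "(\<integral>\<^sup>+x. ennreal (h x) \<partial>M) \<le> C"
proof -
  have "(\<integral>\<^sup>+x. ennreal (h x) \<partial>M) = (\<integral>\<^sup>+x. liminf (\<lambda>i. ennreal (g i x)) \<partial>M)"
  proof (rule nn_integral_cong_AE, use lim in eventually_elim)
    case (elim x)
    then have "(\<lambda>i. ennreal (g i x)) \<longlonglongrightarrow> ennreal (h x)" by (intro tendsto_ennrealI)
    then show ?case by (simp add: lim_imp_Liminf)
  qed
  also have "\<dots> \<le> liminf (\<lambda>i. \<integral>\<^sup>+x. ennreal (g i x) \<partial>M)"
    by (rule nn_integral_liminf) measurable
  also have "\<dots> \<le> limsup (\<lambda>i. \<integral>\<^sup>+x. ennreal (g i x) \<partial>M)"
    by (simp add: Liminf_le_Limsup)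
  also have "\<dots> \<le> C" by (rule Limsup_bounded[OF bound])
  finally show ?thesis .
qed

lemma absolutely_continuous_density_real:
  assumes \<nu>: "prob_space \<nu>" and \<mu>: "prob_space \<mu>" "sets \<mu> = sets \<nu>"
    and ac: "absolutely_continuous \<nu> \<mu>"
  obtains f where "f \<in> borel_measurable \<nu>" "\<And>x. 0 \<le> f x" "(\<integral>\<^sup>+x. ennreal (f x) \<partial>\<nu>) = 1"
    "\<mu> = density \<nu> (\<lambda>x. ennreal (f x))"
proof -
  interpret prob_space \<nu> by fact
  interpret \<mu>: prob_space \<mu> by fact
  obtain f where f [measurable]: "f \<in> borel_measurable \<nu>"
      "AE x in \<nu>. RN_deriv \<nu> \<mu> x = ennreal (f x)" and nn: "\<And>x. 0 \<le> f x"
    using real_RN_deriv[OF \<mu>.finite_measure_axioms ac \<mu>(2)] by metis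
  have "\<mu> = density \<nu> (RN_deriv \<nu> \<mu>)" using density_RN_deriv[OF ac \<mu>(2)] by simp
  also have "\<dots> = density \<nu> (\<lambda>x. ennreal (f x))" using f(2) by (intro density_cong) auto
  finally have \<mu>_eq: "\<mu> = density \<nu> (\<lambda>x. ennreal (f x))" .
  have "(\<integral>\<^sup>+x. ennreal (f x) \<partial>\<nu>) = emeasure \<mu> (space \<mu>)"
    by (subst (1 2) \<mu>_eq) (simp add: emeasure_density cong: nn_integral_cong)
  then show thesis using f(1) nn \<mu>_eq \<mu>.emeasure_space_1 by (intro that[of f]) auto
qed

section \<open>Attainment of minimal relative entropy\<close>

text \<open>The existence of information projections, after Csiszar. If all divergences exceed \<open>r\<close>, then
\<open>r\<close> is their infimum; take densities \<open>f n\<close> with entropies tending to \<open>r\<close>. Midpoints stay in \<open>\<U>\<close> and so have entropy at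
least \<open>r\<close>; hence the convexity gap of \<open>f n\<close> and \<open>f k\<close> tends to 0, and by \<open>abs_diff_le_entropy_gap\<close> the
densities form a Cauchy sequence in \<open>L\<^sup>1\<close>. The limit density belongs to \<open>\<U>\<close>, because convergence in
\<open>L\<^sup>1\<close> implies convergence on every set, and its entropy is at most \<open>r\<close> by Fatou's lemma.\<close>

lemma KL_infimum_attained:
  fixes \<nu> :: "'a measure" and \<U> :: "'a measure set"
  assumes \<nu>: "prob_space \<nu>" and r: "0 \<le> r"
    and \<U>: "\<And>u. u \<in> \<U> \<Longrightarrow> prob_space u \<and> sets u = sets \<nu>"
    and mid: "\<And>u v w. u \<in> \<U> \<Longrightarrow> v \<in> \<U> \<Longrightarrow> prob_space w \<Longrightarrow> sets w = sets \<nu> \<Longrightarrow>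
      (\<And>A. A \<in> sets \<nu> \<Longrightarrow> measure w A = (measure u A + measure v A) / 2) \<Longrightarrow> w \<in> \<U>"
    and lim: "\<And>U w. (\<And>n. U n \<in> \<U>) \<Longrightarrow> prob_space w \<Longrightarrow> sets w = sets \<nu> \<Longrightarrow>
      (\<And>A. A \<in> sets \<nu> \<Longrightarrow> (\<lambda>n. measure (U n) A) \<longlonglongrightarrow> measure w A) \<Longrightarrow> w \<in> \<U>"
    and inf: "(INF u\<in>\<U>. KL u \<nu>) \<le> ereal r"
  shows "\<exists>u\<in>\<U>. KL u \<nu> \<le> ereal r"
proof (rule ccontr)
  assume "\<not> ?thesis"
  then have gt: "ereal r < KL u \<nu>" if "u \<in> \<U>" for u using that by force
  interpret prob_space \<nu> by fact
  define dens where "dens f = density \<nu> (\<lambda>x. ennreal (f x))" for f :: "'a \<Rightarrow> real"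
  define J where "J f = (\<integral>x. entropy_fun (f x) \<partial>\<nu>)" for f
  define adm where "adm f \<longleftrightarrow> f \<in> borel_measurable \<nu> \<and> (\<forall>x. 0 \<le> f x) \<and>
      (\<integral>\<^sup>+x. ennreal (f x) \<partial>\<nu>) = 1 \<and> dens f \<in> \<U>" for f
  have meas_dens: "measure (dens f) A = (\<integral>x. indicator A x * f x \<partial>\<nu>)"
    if "f \<in> borel_measurable \<nu>" "\<And>x. 0 \<le> f x" "A \<in> sets \<nu>" for f A
    unfolding dens_def using that by (simp add: measure_def emeasure_density integral_eq_nn_integral
        ennreal_indicator ennreal_mult'' mult.commute flip: ennreal_indicator)
  have prob_dens: "prob_space (dens f)" if "f \<in> borel_measurable \<nu>" "(\<integral>\<^sup>+x. ennreal (f x) \<partial>\<nu>) = 1" for f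
    unfolding dens_def using that
    by (intro prob_spaceI) (simp add: emeasure_density cong: nn_integral_cong)
  have int_one: "integrable \<nu> f" "(\<integral>x. f x \<partial>\<nu>) = 1"
    if "f \<in> borel_measurable \<nu>" "\<And>x. 0 \<le> f x" "(\<integral>\<^sup>+x. ennreal (f x) \<partial>\<nu>) = 1" for f
    using that by (auto intro!: integrableI_nonneg simp: integral_eq_nn_integral)
  have "\<exists>f. adm f \<and> integrable \<nu> (\<lambda>x. entropy_fun (f x)) \<and> J f \<le> r + 1 / real (Suc n)" for n
  proof -
    have "(INF u\<in>\<U>. KL u \<nu>) < ereal (r + 1 / real (Suc n))"
      using inf by (rule le_less_trans) simp
    then obtain u where u: "u \<in> \<U>" "KL u \<nu> < ereal (r + 1 / real (Suc n))"
      by (auto simp: INF_less_iff)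
    then have "absolutely_continuous \<nu> u" by (auto simp: KL_def split: if_splits)
    then obtain f where f [measurable]: "f \<in> borel_measurable \<nu>" and nn: "\<And>x. 0 \<le> f x"
        and one: "(\<integral>\<^sup>+x. ennreal (f x) \<partial>\<nu>) = 1" and u_eq: "u = dens f"
      using absolutely_continuous_density_real[OF \<nu>] \<U>[OF u(1)] unfolding dens_def by metis
    have "enn2ereal (\<integral>\<^sup>+x. ennreal (entropy_fun (f x)) \<partial>\<nu>) < ereal (r + 1 / real (Suc n))"
      using u(2) KL_density_eq[OF \<nu> f nn one] by (simp add: u_eq dens_def)
    then obtain c where c: "0 \<le> c" "(\<integral>\<^sup>+x. ennreal (entropy_fun (f x)) \<partial>\<nu>) = ennreal c"
        "c \<le> r + 1 / real (Suc n)"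
      by (cases "\<integral>\<^sup>+x. ennreal (entropy_fun (f x)) \<partial>\<nu>") auto
    have "integrable \<nu> (\<lambda>x. entropy_fun (f x))"
      using c entropy_fun_nonneg[OF nn] by (intro integrableI_nonneg) auto
    moreover have "J f = c"
      using c entropy_fun_nonneg[OF nn] by (simp add: J_def integral_eq_nn_integral)
    ultimately show ?thesis using f nn one u(1) u_eq c by (intro exI[of _ f]) (simp add: adm_def)
  qed
  then obtain f where adm: "\<And>n. adm (f n)"
      and ent_int: "\<And>n. integrable \<nu> (\<lambda>x. entropy_fun (f n x))"
      and ent_le: "\<And>n. J (f n) \<le> r + 1 / real (Suc n)" by metis
  have f [measurable]: "f n \<in> borel_measurable \<nu>" and nn: "0 \<le> f n x"
      and one: "(\<integral>\<^sup>+x. ennreal (f n x) \<partial>\<nu>) = 1" and fU: "dens (f n) \<in> \<U>" for n x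
    using adm[of n] by (auto simp: adm_def)
  note fint [simp] = int_one[OF f nn one]
  have dist: "(\<integral>x. \<bar>f n x - f k x\<bar> \<partial>\<nu>) \<le> (1 / real (Suc n) + 1 / real (Suc k)) / e + 2 * e"
    if e: "0 < e" for n k e
  proof -
    define h where "h x = (f n x + f k x) / 2" for x
    have h [measurable]: "h \<in> borel_measurable \<nu>" unfolding h_def by measurable
    have hnn: "0 \<le> h x" for x using nn by (simp add: h_def)
    have gap: "entropy_fun (h x) \<le> (entropy_fun (f n x) + entropy_fun (f k x)) / 2" for x
    proof -
      have "(sqrt (f n x) - sqrt (f k x))\<^sup>2 / 2
          \<le> entropy_fun (f n x) + entropy_fun (f k x) - 2 * entropy_fun (h x)"
        using entropy_gap[OF nn[of n x] nn[of k x]] by (simp add: h_def)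
      moreover have "0 \<le> (sqrt (f n x) - sqrt (f k x))\<^sup>2 / 2" by simp
      ultimately have "2 * entropy_fun (h x) \<le> entropy_fun (f n x) + entropy_fun (f k x)"
        by linarith
      then show ?thesis by simp
    qed
    have hint: "integrable \<nu> (\<lambda>x. entropy_fun (h x))"
    proof (rule Bochner_Integration.integrable_bound)
      show "integrable \<nu> (\<lambda>x. (entropy_fun (f n x) + entropy_fun (f k x)) / 2)"
        using ent_int by simp
      show "AE x in \<nu>. norm (entropy_fun (h x)) \<le> norm ((entropy_fun (f n x) + entropy_fun (f k x)) / 2)"
      proof (intro AE_I2)
        fix x
        show "norm (entropy_fun (h x)) \<le> norm ((entropy_fun (f n x) + entropy_fun (f k x)) / 2)"
          using gap[of x] entropy_fun_nonneg[OF hnn, of x] by (simp only: real_norm_def)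
      qed
    qed measurable
    have hI: "integrable \<nu> h" "(\<integral>x. h x \<partial>\<nu>) = 1" by (simp_all add: h_def[abs_def])
    have hone: "(\<integral>\<^sup>+x. ennreal (h x) \<partial>\<nu>) = 1"
      using hI hnn by (subst nn_integral_eq_integral) auto
    have "dens h \<in> \<U>"
    proof (rule mid[OF fU fU])
      fix A assume A: "A \<in> sets \<nu>"
      have i: "integrable \<nu> (\<lambda>x. indicator A x * f n x)" for n
        using A by (intro integrable_real_mult_indicator[of A \<nu> "f n", simplified mult.commute]) auto
      have "measure (dens h) A = (\<integral>x. (indicator A x * f n x + indicator A x * f k x) / 2 \<partial>\<nu>)"
        using A hnn by (subst meas_dens) (auto simp: h_def algebra_simps intro!: Bochner_Integration.integral_cong)
      also have "\<dots> = (measure (dens (f n)) A + measure (dens (f k)) A) / 2"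
        using i A nn by (simp add: meas_dens)
      finally show "measure (dens h) A = (measure (dens (f n)) A + measure (dens (f k)) A) / 2" .
    qed (use prob_dens[OF h hone] in \<open>auto simp: dens_def\<close>)
    from gt[OF this] have "r \<le> J h"
      using hint entropy_fun_nonneg[OF hnn] KL_density_eq[OF \<nu> h hnn hone] r
      by (simp add: dens_def J_def nn_integral_eq_integral)
    have "(\<integral>x. \<bar>f n x - f k x\<bar> \<partial>\<nu>)
        \<le> (\<integral>x. (entropy_fun (f n x) + entropy_fun (f k x) - 2 * entropy_fun (h x)) / e
              + e * (f n x + f k x) \<partial>\<nu>)"
      using abs_diff_le_entropy_gap[OF nn nn e] hint ent_int unfolding h_def
      by (intro integral_mono) auto
    also have "\<dots> = (J (f n) + J (f k) - 2 * J h) / e + e * 2"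
      using hint ent_int by (simp add: J_def)
    also have "\<dots> \<le> (1 / real (Suc n) + 1 / real (Suc k)) / e + e * 2"
      using ent_le[of n] ent_le[of k] \<open>r \<le> J h\<close> e by (intro add_right_mono divide_right_mono) auto
    finally show ?thesis by (simp add: mult.commute)
  qed
  have cauchy: "\<exists>N. \<forall>n\<ge>N. \<forall>k\<ge>N. (\<integral>x. \<bar>f n x - f k x\<bar> \<partial>\<nu>) < \<epsilon>" if \<epsilon>: "0 < \<epsilon>" for \<epsilon>
  proof -
    \<comment> \<open>The bound dist is used with e = \<epsilon> / 4, so that each of its two terms is at most \<epsilon> / 2.\<close>
    obtain N where N: "1 / real (Suc N) < \<epsilon>\<^sup>2 / 16"
      using nat_approx_posE[of "\<epsilon>\<^sup>2 / 16"] \<epsilon> by auto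
    have "(\<integral>x. \<bar>f n x - f k x\<bar> \<partial>\<nu>) < \<epsilon>" if "N \<le> n" "N \<le> k" for n k
    proof -
      have "1 / real (Suc n) \<le> 1 / real (Suc N)" "1 / real (Suc k) \<le> 1 / real (Suc N)"
        using that by (auto intro!: divide_left_mono)
      then have "1 / real (Suc n) + 1 / real (Suc k) < \<epsilon>\<^sup>2 / 8" using N by linarith
      then have "(1 / real (Suc n) + 1 / real (Suc k)) / (\<epsilon> / 4) < \<epsilon>\<^sup>2 / 8 / (\<epsilon> / 4)"
        using \<epsilon> by (intro divide_strict_right_mono) auto
      also have "\<dots> = \<epsilon> / 2" using \<epsilon> by (simp add: power2_eq_square)
      finally have "(1 / real (Suc n) + 1 / real (Suc k)) / (\<epsilon> / 4) < \<epsilon> / 2" .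
      moreover have "(\<integral>x. \<bar>f n x - f k x\<bar> \<partial>\<nu>)
          \<le> (1 / real (Suc n) + 1 / real (Suc k)) / (\<epsilon> / 4) + 2 * (\<epsilon> / 4)"
        using \<epsilon> by (intro dist) simp
      ultimately show ?thesis by linarith
    qed
    then show ?thesis by blast
  qed
  obtain \<rho> where \<rho>: "strict_mono \<rho>" "AE x in \<nu>. Cauchy (\<lambda>i. f (\<rho> i) x)"
    using cauchy_L1_AE_cauchy_subseq[of \<nu> f] cauchy by auto
  \<comment> \<open>Pointwise limits of densities are nonnegative; the maximum only fixes the values on the null set without convergence.\<close>
  define g where "g x = max 0 (lim (\<lambda>i. f (\<rho> i) x))" for x
  have g [measurable]: "g \<in> borel_measurable \<nu>"
    unfolding g_def by (intro borel_measurable_max borel_measurable_lim_metric) auto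
  have gnn: "0 \<le> g x" for x by (simp add: g_def)
  have conv: "AE x in \<nu>. (\<lambda>i. f (\<rho> i) x) \<longlonglongrightarrow> g x"
    using \<rho>(2)
  proof eventually_elim
    case (elim x)
    then have L: "(\<lambda>i. f (\<rho> i) x) \<longlonglongrightarrow> lim (\<lambda>i. f (\<rho> i) x)"
      by (simp add: Cauchy_convergent_iff convergent_LIMSEQ_iff)
    then have "0 \<le> lim (\<lambda>i. f (\<rho> i) x)" by (rule LIMSEQ_le_const) (use nn in auto)
    then show ?case using L by (simp add: g_def)
  qed
  have "(\<integral>\<^sup>+x. ennreal (g x) \<partial>\<nu>) \<le> 1"
    by (rule nn_integral_le_AE_limit[OF _ conv]) (auto simp: one)
  then have gint: "integrable \<nu> g" using gnn by (intro integrableI_nonneg) (auto simp: le_less_trans)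
  have L1: "(\<lambda>n. \<integral>x. \<bar>f n x - g x\<bar> \<partial>\<nu>) \<longlonglongrightarrow> 0"
  proof (rule LIMSEQ_I)
    fix \<epsilon> :: real assume \<epsilon>: "0 < \<epsilon>"
    then obtain N where N: "\<And>n k. N \<le> n \<Longrightarrow> N \<le> k \<Longrightarrow> (\<integral>x. \<bar>f n x - f k x\<bar> \<partial>\<nu>) < \<epsilon> / 2"
      using cauchy[of "\<epsilon> / 2"] by auto
    have "(\<integral>x. \<bar>f n x - g x\<bar> \<partial>\<nu>) \<le> \<epsilon> / 2" if n: "N \<le> n" for n
    proof -
      have "(\<integral>\<^sup>+x. ennreal \<bar>f n x - g x\<bar> \<partial>\<nu>) \<le> ennreal (\<epsilon> / 2)"
      proof (rule nn_integral_le_AE_limit[where g="\<lambda>i x. \<bar>f n x - f (\<rho> i) x\<bar>"])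
        show "AE x in \<nu>. (\<lambda>i. \<bar>f n x - f (\<rho> i) x\<bar>) \<longlonglongrightarrow> \<bar>f n x - g x\<bar>"
          using conv by eventually_elim (intro tendsto_intros)
        show "\<forall>\<^sub>F i in sequentially. (\<integral>\<^sup>+x. ennreal \<bar>f n x - f (\<rho> i) x\<bar> \<partial>\<nu>) \<le> ennreal (\<epsilon> / 2)"
          using eventually_ge_at_top[of N]
        proof eventually_elim
          case (elim i)
          then have "N \<le> \<rho> i" using seq_suble[OF \<rho>(1), of i] by linarith
          then show ?case using N[OF n, of "\<rho> i"] \<epsilon> by (subst nn_integral_eq_integral) auto
        qed
      qed measurable
      then show ?thesis using \<epsilon> gint by (subst (asm) nn_integral_eq_integral) auto
    qed
    then show "\<exists>N. \<forall>n\<ge>N. norm ((\<integral>x. \<bar>f n x - g x\<bar> \<partial>\<nu>) - 0) < \<epsilon>"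
      using \<epsilon> by (intro exI[of _ N]) (fastforce simp: abs_of_nonneg)
  qed
  have meas_lim: "(\<lambda>n. \<integral>x. indicator A x * f n x \<partial>\<nu>) \<longlonglongrightarrow> (\<integral>x. indicator A x * g x \<partial>\<nu>)"
    if A [measurable]: "A \<in> sets \<nu>" for A
  proof (rule LIM_zero_cancel, rule Lim_null_comparison[OF _ L1], intro always_eventually allI)
    fix n
    have i: "integrable \<nu> (\<lambda>x. indicator A x * u x)" if "integrable \<nu> u" for u :: "'a \<Rightarrow> real"
      using integrable_real_mult_indicator[OF A that] by (simp add: mult.commute)
    have "(\<integral>x. indicator A x * f n x \<partial>\<nu>) - (\<integral>x. indicator A x * g x \<partial>\<nu>)
        = (\<integral>x. indicator A x * (f n x - g x) \<partial>\<nu>)"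
      using i[OF fint(1)[of n]] i[OF gint] by (simp add: right_diff_distrib)
    also have "norm \<dots> \<le> (\<integral>x. norm (indicator A x * (f n x - g x)) \<partial>\<nu>)"
      by (rule integral_norm_bound)
    also have "\<dots> \<le> (\<integral>x. \<bar>f n x - g x\<bar> \<partial>\<nu>)"
      using gint by (intro integral_mono integrable_norm i) (auto simp: indicator_def)
    finally show "norm ((\<integral>x. indicator A x * f n x \<partial>\<nu>) - (\<integral>x. indicator A x * g x \<partial>\<nu>))
        \<le> (\<integral>x. \<bar>f n x - g x\<bar> \<partial>\<nu>)" .
  qed
  have "(\<lambda>n. \<integral>x. f n x \<partial>\<nu>) \<longlonglongrightarrow> (\<integral>x. g x \<partial>\<nu>)"
    using meas_lim[OF sets.top] by (simp cong: Bochner_Integration.integral_cong)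
  then have "(\<integral>x. g x \<partial>\<nu>) = 1" by (simp add: LIMSEQ_const_iff)
  then have gone: "(\<integral>\<^sup>+x. ennreal (g x) \<partial>\<nu>) = 1"
    using gint gnn by (subst nn_integral_eq_integral) auto
  have "dens g \<in> \<U>"
  proof (rule lim[of "\<lambda>n. dens (f n)"])
    show "(\<lambda>n. measure (dens (f n)) A) \<longlonglongrightarrow> measure (dens g) A" if "A \<in> sets \<nu>" for A
      using meas_lim[OF that] that by (simp add: meas_dens nn gnn)
  qed (use fU prob_dens[OF g gone] in \<open>auto simp: dens_def\<close>)
  have le_eps: "(\<integral>\<^sup>+x. ennreal (entropy_fun (g x)) \<partial>\<nu>) \<le> ennreal (r + \<eta>)" if \<eta>: "0 < \<eta>" for \<eta>
  proof (rule nn_integral_le_AE_limit[where g="\<lambda>i x. entropy_fun (f (\<rho> i) x)"])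
    show "AE x in \<nu>. (\<lambda>i. entropy_fun (f (\<rho> i) x)) \<longlonglongrightarrow> entropy_fun (g x)"
      using conv by eventually_elim
        (rule continuous_on_tendsto_compose[OF continuous_on_entropy_fun], auto simp: nn gnn)
    obtain N where N: "1 / real (Suc N) < \<eta>" using nat_approx_posE[OF \<eta>] by auto
    show "\<forall>\<^sub>F i in sequentially. (\<integral>\<^sup>+x. ennreal (entropy_fun (f (\<rho> i) x)) \<partial>\<nu>) \<le> ennreal (r + \<eta>)"
      using eventually_ge_at_top[of N]
    proof eventually_elim
      case (elim i)
      then have "1 / real (Suc (\<rho> i)) \<le> 1 / real (Suc N)"
        using seq_suble[OF \<rho>(1), of i] by (intro divide_left_mono) auto
      then have "J (f (\<rho> i)) \<le> r + \<eta>" using ent_le[of "\<rho> i"] N by linarith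
      then show ?case
        using ent_int entropy_fun_nonneg[OF nn]
        by (subst nn_integral_eq_integral) (auto simp: J_def intro!: ennreal_leI)
    qed
  qed measurable
  have "(\<integral>\<^sup>+x. ennreal (entropy_fun (g x)) \<partial>\<nu>) \<le> ennreal r"
  proof (rule ennreal_le_epsilon)
    fix \<eta> :: real assume "0 < \<eta>"
    then show "(\<integral>\<^sup>+x. ennreal (entropy_fun (g x)) \<partial>\<nu>) \<le> ennreal r + ennreal \<eta>"
      using le_eps[of \<eta>] r by simp
  qed
  then have "KL (dens g) \<nu> \<le> ereal r"
    unfolding dens_def KL_density_eq[OF \<nu> g gnn gone] using r
    by (simp add: less_eq_ennreal.rep_eq)
  with gt[OF \<open>dens g \<in> \<U>\<close>] show False by simp
qed

section \<open>The coupling form of the predictor\<close>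

text \<open>For a fixed \<open>Q\<close> the constraints of the two problems agree. The Levy-Prokhorov ball is described by
inequalities that are affine in the measure, so it is stable under midpoints and under convergence on every
Borel set. The infimum that defines the smoothed divergence is therefore attained, and the minimizer is
coupled with the empirical measure.\<close>

lemma obs_div_smooth_le_iff_coupling:
  fixes K :: "'a::topological_space \<Rightarrow> 'b::metric_space measure" and s :: "nat \<Rightarrow> 'b"
  assumes K: "K \<in> borel \<rightarrow>\<^sub>M prob_algebra borel" and N: "1 \<le> N" and \<delta>: "0 < \<delta>" and r: "0 < r"
    and Q: "Q \<in> space (prob_algebra borel)"
  defines "Y \<equiv> supp (empirical N s)"
  shows "obs_div_smooth \<delta> K (empirical N s) Q \<le> ereal r \<longleftrightarrow>
    (\<exists>P T. P \<in> pos_measures borel \<and> T \<in> pos_measures (borel \<Otimes>\<^sub>M restrict_space borel Y) \<and>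
      obs_div K P Q \<le> ereal r \<and> distr T borel fst = P \<and>
      distr T (restrict_space borel Y) snd = restrict_space (empirical N s) Y \<and>
      (\<integral>p. indicator {p. dist (fst p) (snd p) \<le> \<delta>} p \<partial>T) \<ge> 1 - \<delta>)"
proof -
  let ?\<mu> = "empirical N s"
  define \<nu> where "\<nu> = bind Q K"
  have "(\<lambda>_::unit. bind Q K) \<in> count_space UNIV \<rightarrow>\<^sub>M prob_algebra borel"
    using Q K by (intro measurable_bind_prob_space[where N=borel]) auto
  then have \<nu>_in: "\<nu> \<in> space (prob_algebra borel)"
    by (auto simp: measurable_def \<nu>_def)
  then have \<nu>: "prob_space \<nu>" "sets \<nu> = sets borel" by (auto simp: space_prob_algebra)
  have Y_eq: "Y = s ` {1..N}" using supp_empirical[OF N] by (simp add: Y_def)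
  then have fin: "finite Y" by simp
  have finB: "F \<in> sets borel" if "F \<subseteq> Y" for F
    using that fin by (intro borel_closed finite_imp_closed) (rule finite_subset)
  have \<mu>: "?\<mu> \<in> space (prob_algebra borel)"
    using prob_space_empirical[OF N] by (simp add: space_prob_algebra)
  have conc: "measure ?\<mu> Y = 1"
    using N by (simp add: measure_empirical[OF finB] Y_eq)
  define \<U> where "\<U> = {\<upsilon> \<in> space (prob_algebra borel). LP \<upsilon> ?\<mu> \<le> \<delta>}"
  have smooth: "obs_div_smooth \<delta> K ?\<mu> Q = (INF \<upsilon>\<in>\<U>. KL \<upsilon> \<nu>)"
    unfolding obs_div_smooth_def obs_div_def \<nu>_def \<U>_def by (auto intro!: arg_cong[where f=Inf])
  have \<U>_iff: "\<upsilon> \<in> \<U> \<longleftrightarrow> (\<forall>B\<in>sets borel. \<forall>C\<in>sets borel. (\<Union>x\<in>B. cball x \<delta>) \<subseteq> C \<longrightarrow>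
      measure ?\<mu> B \<le> measure \<upsilon> C + \<delta>)" if "prob_space \<upsilon>" "sets \<upsilon> = sets borel" for \<upsilon>
    using that LP_empirical_le_iff[OF _ N \<delta>, of \<upsilon> s] by (simp add: \<U>_def space_prob_algebra)
  have \<U>_prob: "prob_space \<upsilon> \<and> sets \<upsilon> = sets \<nu>" if "\<upsilon> \<in> \<U>" for \<upsilon>
    using that \<nu> by (simp add: \<U>_def space_prob_algebra)
  have \<U>_le: "measure ?\<mu> B \<le> measure \<upsilon> C + \<delta>"
    if "\<upsilon> \<in> \<U>" "B \<in> sets borel" "C \<in> sets borel" "(\<Union>x\<in>B. cball x \<delta>) \<subseteq> C" for \<upsilon> B C
    using \<U>_iff[of \<upsilon>] \<U>_prob[OF that(1)] \<nu>(2) that by simp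
  show ?thesis
  proof
    assume "obs_div_smooth \<delta> K ?\<mu> Q \<le> ereal r"
    then have inf: "(INF \<upsilon>\<in>\<U>. KL \<upsilon> \<nu>) \<le> ereal r" by (simp add: smooth)
    have "\<exists>\<upsilon>\<in>\<U>. KL \<upsilon> \<nu> \<le> ereal r"
    proof (rule KL_infimum_attained[OF \<nu>(1) _ \<U>_prob _ _ inf])
      fix u v w :: "'b measure"
      assume u: "u \<in> \<U>" and v: "v \<in> \<U>" and w: "prob_space w" "sets w = sets \<nu>"
        and mid: "\<And>A. A \<in> sets \<nu> \<Longrightarrow> measure w A = (measure u A + measure v A) / 2"
      show "w \<in> \<U>"
        unfolding \<U>_iff[OF w[unfolded \<nu>(2)]]
      proof (intro ballI impI)
        fix B C :: "'b set"
        assume *: "B \<in> sets borel" "C \<in> sets borel" "(\<Union>x\<in>B. cball x \<delta>) \<subseteq> C"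
        show "measure ?\<mu> B \<le> measure w C + \<delta>" using \<U>_le[OF u *] \<U>_le[OF v *] mid[of C] * \<nu>(2) by simp
      qed
    next
      fix U and w :: "'b measure"
      assume U: "\<And>n. U n \<in> \<U>" and w: "prob_space w" "sets w = sets \<nu>"
        and lim: "\<And>A. A \<in> sets \<nu> \<Longrightarrow> (\<lambda>n. measure (U n) A) \<longlonglongrightarrow> measure w A"
      show "w \<in> \<U>"
        unfolding \<U>_iff[OF w[unfolded \<nu>(2)]]
      proof (intro ballI impI)
        fix B C :: "'b set"
        assume *: "B \<in> sets borel" "C \<in> sets borel" "(\<Union>x\<in>B. cball x \<delta>) \<subseteq> C"
        have "(\<lambda>n. measure (U n) C + \<delta>) \<longlonglongrightarrow> measure w C + \<delta>"
          using lim[of C] * \<nu>(2) by (intro tendsto_intros) auto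
        then show "measure ?\<mu> B \<le> measure w C + \<delta>"
          by (rule LIMSEQ_le_const) (use \<U>_le[OF U *] in auto)
      qed
    qed (use r in auto)
    then obtain \<upsilon> where \<upsilon>: "\<upsilon> \<in> \<U>" "KL \<upsilon> \<nu> \<le> ereal r" by blast
    have near: "measure ?\<mu> F \<le> measure \<upsilon> (\<Union>y\<in>F. cball y \<delta>) + \<delta>" if F: "F \<subseteq> Y" for F
    proof -
      have "(\<Union>y\<in>F. cball y \<delta>) \<in> sets borel"
        using finite_subset[OF F fin] by (intro borel_closed closed_UN) auto
      then show ?thesis using \<U>_le[OF \<upsilon>(1) finB[OF F]] by simp
    qed
    have \<upsilon>_in: "\<upsilon> \<in> space (prob_algebra borel)" using \<upsilon>(1) by (simp add: \<U>_def)
    obtain T where "T \<in> pos_measures (borel \<Otimes>\<^sub>M restrict_space borel Y)" "distr T borel fst = \<upsilon>"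
      "distr T (restrict_space borel Y) snd = restrict_space ?\<mu> Y"
      "1 - \<delta> \<le> measure T ({q. dist (fst q) (snd q) \<le> \<delta>} \<inter> space T)"
      using coupling_of_near[OF \<upsilon>_in \<mu> fin conc _ near] \<delta> by auto
    moreover have "\<upsilon> \<in> pos_measures borel" using \<upsilon>_in by (simp add: pos_measures_def space_prob_algebra)
    moreover have "obs_div K \<upsilon> Q \<le> ereal r" using \<upsilon>(2) by (simp add: obs_div_def \<nu>_def)
    ultimately show "\<exists>P T. P \<in> pos_measures borel \<and> T \<in> pos_measures (borel \<Otimes>\<^sub>M restrict_space borel Y) \<and>
      obs_div K P Q \<le> ereal r \<and> distr T borel fst = P \<and>
      distr T (restrict_space borel Y) snd = restrict_space ?\<mu> Y \<and>
      (\<integral>p. indicator {p. dist (fst p) (snd p) \<le> \<delta>} p \<partial>T) \<ge> 1 - \<delta>"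
      by (intro exI[of _ \<upsilon>] exI[of _ T]) simp
  next
    assume "\<exists>P T. P \<in> pos_measures borel \<and> T \<in> pos_measures (borel \<Otimes>\<^sub>M restrict_space borel Y) \<and>
      obs_div K P Q \<le> ereal r \<and> distr T borel fst = P \<and>
      distr T (restrict_space borel Y) snd = restrict_space ?\<mu> Y \<and>
      (\<integral>p. indicator {p. dist (fst p) (snd p) \<le> \<delta>} p \<partial>T) \<ge> 1 - \<delta>"
    then obtain T where T: "T \<in> pos_measures (borel \<Otimes>\<^sub>M restrict_space borel Y)"
        "distr T (restrict_space borel Y) snd = restrict_space ?\<mu> Y"
        "1 - \<delta> \<le> measure T ({q. dist (fst q) (snd q) \<le> \<delta>} \<inter> space T)"
      and KL: "KL (distr T borel fst) \<nu> \<le> ereal r"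
      by (auto simp: obs_div_def \<nu>_def)
    note * = near_of_coupling[OF \<mu> fin conc T]
    have "LP (distr T borel fst) ?\<mu> \<le> \<delta>"
      unfolding LP_empirical_le_iff[OF *(1) N \<delta>] by (intro ballI impI *(2))
    then have "distr T borel fst \<in> \<U>" using *(1) by (simp add: \<U>_def)
    then show "obs_div_smooth \<delta> K ?\<mu> Q \<le> ereal r"
      unfolding smooth using KL by (rule INF_lower2)
  qed
qed

theorem theorem3p1:
  fixes l :: "'z \<Rightarrow> 'a::polish_space \<Rightarrow> real"
    and K :: "'a \<Rightarrow> 'b::polish_space measure"
    and s :: "nat \<Rightarrow> 'b"
    and N :: nat
    and \<delta> r :: real
    and z :: 'z
  assumes "\<And>z. l z \<in> borel_measurable borel"
    and "K \<in> borel \<rightarrow>\<^sub>M prob_algebra borel"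
    and "1 \<le> N"
    and "0 < \<delta>"
    and "0 < r"
  shows "predictor l K r \<delta> z (empirical N s) =
    Sup {ext_integral Q (l z) | Q P T.
      Q \<in> space (prob_algebra borel) \<and>
      P \<in> pos_measures borel \<and>
      T \<in> pos_measures (borel \<Otimes>\<^sub>M restrict_space borel (supp (empirical N s))) \<and>
      obs_div K P Q \<le> ereal r \<and>
      distr T borel fst = P \<and>
      distr T (restrict_space borel (supp (empirical N s))) snd
        = restrict_space (empirical N s) (supp (empirical N s)) \<and>
      (\<integral>p. indicator {p. dist (fst p) (snd p) \<le> \<delta>} p \<partial>T) \<ge> 1 - \<delta>}"
proof -
  let ?Y = "supp (empirical N s)"
  have "x = ext_integral Q (l z) \<and> Q \<in> space (prob_algebra borel) \<and>
      obs_div_smooth \<delta> K (empirical N s) Q \<le> ereal r \<longleftrightarrow>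
    (\<exists>P T. x = ext_integral Q (l z) \<and> Q \<in> space (prob_algebra borel) \<and>
      P \<in> pos_measures borel \<and> T \<in> pos_measures (borel \<Otimes>\<^sub>M restrict_space borel ?Y) \<and>
      obs_div K P Q \<le> ereal r \<and> distr T borel fst = P \<and>
      distr T (restrict_space borel ?Y) snd = restrict_space (empirical N s) ?Y \<and>
      (\<integral>p. indicator {p. dist (fst p) (snd p) \<le> \<delta>} p \<partial>T) \<ge> 1 - \<delta>)" for Q x
    by (cases "Q \<in> space (prob_algebra borel)")
      (simp_all only: obs_div_smooth_le_iff_coupling[OF assms(2-5)] simp_thms ex_simps)
  then show ?thesis
    unfolding predictor_def by (simp only:)
qed

end
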